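(* Consider the $t$-indexed extreme shock model with possibly increasing threshold described in the context. Suppose that $$\lim_{t\to\infty}\frac{\bar F(\beta(t))}{\bar F(\gamma(t))}=g\in(0,1)\qquad\text{and}\qquad \lim_{t\to\infty}\frac{\bar F(\alpha(t)+b_k(t)-c_l(t))}{\bar F(\beta(t))}=a_{k,l}\in(0,1]\quad\text{for all }k,l\ge0 .$$ Let $z\ge0$. (i) For every integer $k\ge0$, $$\lim_{t\to\infty}P\{\nu\ge z/\bar F(\beta),\,N_+(\nu)=k,\,N_-(\nu)=0\}=\frac{g(1-g)^k a_{k,0}}{k!}\int_{z/g}^\infty v^k e^{-v}\,dv .$$ (ii) For all integers $l\ge1$ and $k\ge0$, $$\lim_{t\to\infty}P\{\nu\ge z/\bar F(\beta),\,N_+(\nu)=k,\,N_-(\nu)=l\}=\frac{\left(\frac{1-g}{g}\right)^k\prod_{h=0}^{l-1}(1-a_{k,h})\,a_{k,l}}{k!\,(l-1)!}\int_z^\infty\left(\int_0^1 y^k(1-y)^{l-1}\exp\{-yu(g^{-1}-1)\}\,dy\right)e^{-u}u^{k+l}\,du .$$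
   Context: Let $X_1,X_2,\dots$ be i.i.d. real random variables (shock magnitudes), with $F(x)=P\{X_1<x\}$ and $\bar F(x)=1-F(x)=P\{X_1\ge x\}$; let $x_F\le\infty$ be the upper endpoint of the distribution, assumed to be a continuity point of $F$. For each $t$ let $\gamma=\gamma(t)\le\beta=\beta(t)\le\alpha=\alpha(t)$ be real numbers, with $\bar F(\beta(t))>0$, and all three tending to $x_F$ as $t\to\infty$ (so $\bar F(\beta(t))\to0$). For each $t$ let $(b_k)_{k\ge0}=(b_k(t))$ and $(c_l)_{l\ge0}=(c_l(t))$ be nondecreasing real sequences with $b_0=c_0=0$, $b_1>0$, such that $\alpha_{k,l}:=\alpha+b_k-c_l\ge\beta$ for all $k,l\ge0$. For each $t$ define recursively $N_-(0)=N_+(0)=0$ and, for $n\ge1$, the number of weakening shocks before the $n$-th shock $$N_-(n)=\sum_{1\le i<n}1\{X_i\in[\beta,\ \alpha+b_{N_+(i)}-c_{N_-(i)})\},$$ and the number of strengthening shocks before the $n$-th shock (and before the first weakening shock) $$N_+(n)=\sum_{1\le i<n}1\{X_i\in[\gamma,\beta),\ N_-(i)=0\}.$$ The index of the first fatal shock is $\nu=\nu(t)=\min\{i\ge1:X_i\ge\alpha+b_{N_+(i)}-c_{N_-(i)}\}$ (with value $\infty$ if the set is empty). Events involving $N_\pm(\nu)$ are understood to be intersected with $\{\nu<\infty\}$. The dependence of $\nu,N_+,N_-,\beta$ on $t$ is suppressed in the notation. *)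

theory Defs
  imports "HOL-Probability.Probability"
begin

text \<open>The distribution function is the left-continuous one, as opposed to the library's \<^const>\<open>cdf\<close>.\<close>

definition left_cdf :: "'a measure \<Rightarrow> ('a \<Rightarrow> real) \<Rightarrow> real \<Rightarrow> real" where
  "left_cdf M Y x = measure M {\<omega> \<in> space M. Y \<omega> < x}"

definition tail :: "'a measure \<Rightarrow> ('a \<Rightarrow> real) \<Rightarrow> real \<Rightarrow> real" where
  "tail M Y x = 1 - left_cdf M Y x"

definition upper_endpoint :: "'a measure \<Rightarrow> ('a \<Rightarrow> real) \<Rightarrow> ereal" where
  "upper_endpoint M Y = Sup {ereal x | x. left_cdf M Y x < 1}"

text \<open>Below, \<open>x\<close> is one realisation of the shock sequence; its entry \<open>x 0\<close> is never used.\<close>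

fun N_minus N_plus ::
  "real \<Rightarrow> real \<Rightarrow> real \<Rightarrow> (nat \<Rightarrow> real) \<Rightarrow> (nat \<Rightarrow> real) \<Rightarrow> (nat \<Rightarrow> real) \<Rightarrow> nat \<Rightarrow> nat"
where
  "N_minus \<alpha> \<beta> \<gamma> b c x n =
     (\<Sum>i\<in>{1..<n}. of_bool (x i \<in> {\<beta>..<\<alpha> + b (N_plus \<alpha> \<beta> \<gamma> b c x i) - c (N_minus \<alpha> \<beta> \<gamma> b c x i)}))"
| "N_plus \<alpha> \<beta> \<gamma> b c x n =
     (\<Sum>i\<in>{1..<n}. of_bool (x i \<in> {\<gamma>..<\<beta>} \<and> N_minus \<alpha> \<beta> \<gamma> b c x i = 0))"

declare N_minus.simps [simp del] N_plus.simps [simp del]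

text \<open>The infimum of the empty set is \<open>\<infinity>\<close> in \<^typ>\<open>enat\<close>.\<close>

definition fatal_index ::
  "real \<Rightarrow> real \<Rightarrow> real \<Rightarrow> (nat \<Rightarrow> real) \<Rightarrow> (nat \<Rightarrow> real) \<Rightarrow> (nat \<Rightarrow> real) \<Rightarrow> enat"
where
  "fatal_index \<alpha> \<beta> \<gamma> b c x =
     Inf {enat i | i. 1 \<le> i \<and>
       x i \<ge> \<alpha> + b (N_plus \<alpha> \<beta> \<gamma> b c x i) - c (N_minus \<alpha> \<beta> \<gamma> b c x i)}"

definition shock_event ::
  "'a measure \<Rightarrow> (nat \<Rightarrow> 'a \<Rightarrow> real) \<Rightarrow> real \<Rightarrow> real \<Rightarrow> real \<Rightarrow> (nat \<Rightarrow> real) \<Rightarrow> (nat \<Rightarrow> real)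
     \<Rightarrow> real \<Rightarrow> nat \<Rightarrow> nat \<Rightarrow> 'a set"
where
  "shock_event M X \<alpha> \<beta> \<gamma> b c s k l =
     {\<omega> \<in> space M. \<exists>n. fatal_index \<alpha> \<beta> \<gamma> b c (\<lambda>i. X i \<omega>) = enat n \<and> real n \<ge> s \<and>
        N_plus \<alpha> \<beta> \<gamma> b c (\<lambda>i. X i \<omega>) n = k \<and> N_minus \<alpha> \<beta> \<gamma> b c (\<lambda>i. X i \<omega>) n = l}"

end

theory Submission
  imports Defs
begin

text \<open>
  While no shock has been fatal, the pair \<open>(N_+, N_-)\<close> is a Markov chain: the current state is
  determined by the earlier shocks, so it is independent of the next one. Writing
  \<open>p\<close>, \<open>q\<close>, \<open>T h\<close> for the tails at \<open>\<beta>\<close>, \<open>\<gamma>\<close>, \<open>\<alpha> + b k - c h\<close>, its recursion is solved by binomial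
  expressions: after \<open>n\<close> shocks the state is \<open>(k, 0)\<close> with probability
  \<open>(n choose k) (q - p)^k (1 - q)^(n - k)\<close>, and for \<open>l \<ge> 1\<close> the probability of \<open>(k, l)\<close> is
  \<open>\<Prod>h<l. p - T h\<close> times a discrete convolution of two such terms, over the time of the first
  weakening shock. The event of the theorem then has probability
  \<open>\<Sum>n. (state probability after n shocks) * T l\<close> over \<open>n + 1 \<ge> z / p\<close>. Read as the integral of a step
  function with step width \<open>q\<close> (for \<open>l = 0\<close>) or \<open>p\<close> (for \<open>l \<ge> 1\<close>), this sum converges by dominated
  convergence; the convolution is treated in the same way with step width \<open>1 / n\<close>.
\<close>

subsection \<open>Sums as integrals of step functions\<close>

text \<open>The integrand equals \<open>f n\<close> on an interval of length \<open>p\<close>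
  starting at \<open>n * p\<close>. Nonnegativity lets sum and integral be exchanged in
  \<open>ennreal\<close>; the real integral is recovered at the end.\<close>

lemma sums_imp_integral_step:
  fixes f :: "nat \<Rightarrow> real"
  assumes p: "p > 0" and f: "\<And>n. f n \<ge> 0" and S: "f sums S"
  shows "(LBINT u:{0..}. f (nat \<lfloor>u / p\<rfloor>)) = p * S"
proof -
  have S0: "S \<ge> 0"
    using S f by (metis sums_iff suminf_nonneg)
  \<comment> \<open>For \<open>u \<ge> 0\<close> exactly one of these intervals contains
    \<open>u\<close>, the one with index \<open>m\<close> below; for negative \<open>u\<close> none
    does.\<close>
  have step: "ennreal (indicator {0..} u * f (nat \<lfloor>u / p\<rfloor>)) =
      (\<Sum>n. ennreal (f n) * indicator {real n * p..<real n * p + p} u)" for u :: real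
  proof (cases "u \<ge> 0")
    case True
    define m where "m = nat \<lfloor>u / p\<rfloor>"
    have iff: "u \<in> {real n * p..<real n * p + p} \<longleftrightarrow> n = m" for n
    proof -
      have "u \<in> {real n * p..<real n * p + p} \<longleftrightarrow> real n \<le> u / p \<and> u / p < real n + 1"
        using p by (simp add: field_simps)
      also have "\<dots> \<longleftrightarrow> \<lfloor>u / p\<rfloor> = int n"
        by (simp add: floor_eq_iff)
      also have "\<dots> \<longleftrightarrow> n = m"
        using True p by (auto simp: m_def)
      finally show ?thesis .
    qed
    have "(\<Sum>n. ennreal (f n) * indicator {real n * p..<real n * p + p} u) =
        (\<Sum>n. if n = m then ennreal (f m) else 0)"
      by (intro arg_cong[where f = suminf] ext) (simp only: indicator_def iff, auto)
    also have "\<dots> = ennreal (f m)"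
      by (subst suminf_finite[where N = "{m}"]) auto
    finally show ?thesis using True by (simp add: m_def)
  next
    case False
    have "u \<notin> {real n * p..<real n * p + p}" for n
      using False p by (auto simp: not_le) (smt (verit) mult_nonneg_nonneg of_nat_0_le_iff)
    then show ?thesis using False by simp
  qed
  have "(\<integral>\<^sup>+u. ennreal (indicator {0..} u * f (nat \<lfloor>u / p\<rfloor>)) \<partial>lborel) =
      (\<Sum>n. \<integral>\<^sup>+u. ennreal (f n) * indicator {real n * p..<real n * p + p} u \<partial>lborel)"
    unfolding step by (intro nn_integral_suminf) simp
  also have "\<dots> = (\<Sum>n. ennreal (f n * p))"
    using p by (intro arg_cong[where f = suminf] ext)
      (simp add: nn_integral_cmult_indicator ennreal_mult f)
  also have "\<dots> = ennreal (p * S)"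
    using sums_mult2[OF S, of p] p f
    by (subst suminf_ennreal_eq[where x = "p * S"]) (simp_all add: mult.commute)
  finally have "(\<integral>\<^sup>+u. ennreal (indicator {0..} u * f (nat \<lfloor>u / p\<rfloor>)) \<partial>lborel) = ennreal (p * S)" .
  then show ?thesis
    using p S0 f unfolding set_lebesgue_integral_def
    by (subst integral_eq_nn_integral) (simp_all add: indicator_def)
qed

text \<open>Rounding \<open>u\<close> down to a multiple of \<open>p t\<close> loses at most one
  step width, which vanishes in the limit.\<close>

lemma floor_scaled_tendsto:
  fixes p :: "real \<Rightarrow> real"
  assumes p: "\<forall>\<^sub>F t in F. p t > 0" and p0: "(p \<longlongrightarrow> 0) F" and u: "u \<ge> 0"
  shows "((\<lambda>t. real (nat \<lfloor>u / p t\<rfloor>) * p t) \<longlongrightarrow> u) F"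
proof (rule tendsto_sandwich)
  have floor_real: "real (nat \<lfloor>u / p t\<rfloor>) = real_of_int \<lfloor>u / p t\<rfloor>" if "p t > 0" for t
    using that u by simp
  show "\<forall>\<^sub>F t in F. u - p t \<le> real (nat \<lfloor>u / p t\<rfloor>) * p t"
    using p
  proof eventually_elim
    case (elim t)
    have "u / p t - 1 \<le> real_of_int \<lfloor>u / p t\<rfloor>" by linarith
    then have "(u / p t - 1) * p t \<le> real_of_int \<lfloor>u / p t\<rfloor> * p t"
      using elim by (intro mult_right_mono) auto
    then show ?case using elim by (simp add: floor_real algebra_simps)
  qed
  show "\<forall>\<^sub>F t in F. real (nat \<lfloor>u / p t\<rfloor>) * p t \<le> u"
    using p
  proof eventually_elim
    case (elim t)
    have "real_of_int \<lfloor>u / p t\<rfloor> \<le> u / p t" by linarith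
    then show ?case using elim
      by (simp add: floor_real pos_le_divide_eq del: of_int_floor_le)
  qed
  show "((\<lambda>t. u - p t) \<longlongrightarrow> u) F"
    using tendsto_diff[OF tendsto_const p0, of u] by simp
qed simp

text \<open>By \<open>sums_imp_integral_step\<close>, \<open>S t\<close> is the integral of a step
  function with values \<open>f t n / p t\<close>, and dominated convergence applies. In the limit
  the cutoff on \<open>n\<close> becomes \<open>\<zeta> \<le> u\<close>. Convergence is asked for
  almost everywhere, so that single points such as the end of a convolution range can be
  excluded.\<close>

lemma sum_tendsto_integral:
  fixes p s S :: "real \<Rightarrow> real" and f :: "real \<Rightarrow> nat \<Rightarrow> real" and \<phi> w :: "real \<Rightarrow> real"
  assumes p: "\<forall>\<^sub>F t in at_top. p t > 0" and p0: "(p \<longlongrightarrow> 0) at_top"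
    and s: "((\<lambda>t. s t * p t) \<longlongrightarrow> \<zeta>) at_top" and \<zeta>: "\<zeta> \<ge> 0"
    and f: "\<forall>\<^sub>F t in at_top. \<forall>n. f t n \<ge> 0"
    and S: "\<forall>\<^sub>F t in at_top. (\<lambda>n. if real (Suc n) \<ge> s t then f t n else 0) sums S t"
    and lim: "AE u in lborel. 0 < u \<longrightarrow> ((\<lambda>t. f t (nat \<lfloor>u / p t\<rfloor>) / p t) \<longlongrightarrow> \<phi> u) at_top"
    and \<phi>: "\<phi> \<in> borel_measurable lborel"
    and w: "set_integrable lborel {0..} w"
    and bound: "\<forall>\<^sub>F t in at_top. \<forall>u\<ge>0. f t (nat \<lfloor>u / p t\<rfloor>) / p t \<le> w u"
  shows "(S \<longlongrightarrow> (LBINT u:{\<zeta>..}. \<phi> u)) at_top"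
proof -
  \<comment> \<open>In the applications to shocks, \<open>n\<close> counts the shocks survived and
    the fatal one has index \<open>Suc n\<close>, hence the shift in the cutoff.\<close>
  define h where "h t u = indicator {0..} u *
    (if real (Suc (nat \<lfloor>u / p t\<rfloor>)) \<ge> s t then f t (nat \<lfloor>u / p t\<rfloor>) / p t else 0)" for t u
  have "((\<lambda>t. integral\<^sup>L lborel (h t)) \<longlongrightarrow> (\<integral>u. indicator {\<zeta>..} u * \<phi> u \<partial>lborel)) at_top"
  proof (rule integral_dominated_convergence_at_top[where w = "\<lambda>u. indicator {0..} u * w u"])
    show "(\<lambda>u. indicator {\<zeta>..} u * \<phi> u) \<in> borel_measurable lborel"
      using \<phi> by simp
    show "\<And>t. h t \<in> borel_measurable lborel"
      unfolding h_def by measurable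
    show "integrable lborel (\<lambda>u. indicator {0..} u * w u)"
      using w by (simp add: set_integrable_def)
    show "\<forall>\<^sub>F t in at_top. AE u in lborel. norm (h t u) \<le> indicator {0..} u * w u"
      using bound f p
    proof eventually_elim
      case (elim t)
      have "f t (nat \<lfloor>u / p t\<rfloor>) / p t \<ge> 0" for u
        using elim by simp
      moreover have "w u \<ge> 0" if "u \<ge> 0" for u
        using elim(1) that calculation order_trans by blast
      ultimately show ?case
        using elim(1) by (auto simp: h_def indicator_def)
    qed
    show "AE u in lborel. ((\<lambda>t. h t u) \<longlongrightarrow> indicator {\<zeta>..} u * \<phi> u) at_top"
      \<comment> \<open>At \<open>u = \<zeta>\<close> the cutoff may keep switching between true and
        false, and \<open>lim\<close> speaks of positive \<open>u\<close> only; both points are null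
        sets.\<close>
      using lim AE_lborel_singleton[of 0] AE_lborel_singleton[of \<zeta>]
    proof eventually_elim
      case (elim u)
      consider "u < 0" | "0 < u" "u < \<zeta>" | "u > \<zeta>"
        using elim by linarith
      then show ?case
      proof cases
        case 1
        then show ?thesis using \<zeta> by (simp add: h_def)
      next
        case 2
        \<comment> \<open>This is \<open>p t\<close> times the difference between
          \<open>Suc n\<close> and \<open>s t\<close>, where \<open>n\<close> is the rounded index.
          The sign of the limit \<open>u - \<zeta>\<close> therefore decides the cutoff, here and in
          the next case.\<close>
        have "((\<lambda>t. real (nat \<lfloor>u / p t\<rfloor>) * p t + p t - s t * p t) \<longlongrightarrow> u + 0 - \<zeta>) at_top"
          using 2 by (intro tendsto_intros floor_scaled_tendsto p p0 s) simp
        then have "\<forall>\<^sub>F t in at_top. real (nat \<lfloor>u / p t\<rfloor>) * p t + p t - s t * p t < 0"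
          by (rule order_tendstoD) (use 2 in simp)
        then have "\<forall>\<^sub>F t in at_top. h t u = 0"
          using p
        proof eventually_elim
          case (elim t)
          then have "real (Suc (nat \<lfloor>u / p t\<rfloor>)) * p t < s t * p t"
            by (simp add: algebra_simps)
          then show ?case using elim by (simp add: h_def)
        qed
        then show ?thesis using 2 by (simp add: tendsto_eventually)
      next
        case 3
        have "((\<lambda>t. real (nat \<lfloor>u / p t\<rfloor>) * p t + p t - s t * p t) \<longlongrightarrow> u + 0 - \<zeta>) at_top"
          using 3 \<zeta> by (intro tendsto_intros floor_scaled_tendsto p p0 s) simp
        then have "\<forall>\<^sub>F t in at_top. real (nat \<lfloor>u / p t\<rfloor>) * p t + p t - s t * p t > 0"
          by (rule order_tendstoD) (use 3 in simp)
        then have "\<forall>\<^sub>F t in at_top. f t (nat \<lfloor>u / p t\<rfloor>) / p t = h t u"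
          using p
        proof eventually_elim
          case (elim t)
          then have "real (Suc (nat \<lfloor>u / p t\<rfloor>)) * p t > s t * p t"
            by (simp add: algebra_simps)
          then have "real (Suc (nat \<lfloor>u / p t\<rfloor>)) > s t"
            using elim by (simp add: mult_less_cancel_right)
          then show ?case using 3 \<zeta> by (simp add: h_def)
        qed
        moreover have "((\<lambda>t. f t (nat \<lfloor>u / p t\<rfloor>) / p t) \<longlongrightarrow> \<phi> u) at_top"
          using elim 3 \<zeta> by simp
        ultimately show ?thesis using 3 by (simp add: tendsto_cong)
      qed
    qed
  qed
  moreover have "\<forall>\<^sub>F t in at_top. integral\<^sup>L lborel (h t) = S t"
    using S f p
  proof eventually_elim
    case (elim t)
    let ?f = "\<lambda>n. (if real (Suc n) \<ge> s t then f t n else 0)"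
    have "(LBINT u:{0..}. ?f (nat \<lfloor>u / p t\<rfloor>)) = p t * S t"
      by (rule sums_imp_integral_step) (use elim in auto)
    moreover have "integral\<^sup>L lborel (h t) = (LBINT u:{0..}. ?f (nat \<lfloor>u / p t\<rfloor>)) / p t"
      unfolding set_lebesgue_integral_def
      unfolding integral_divide_zero[symmetric]
      by (rule Bochner_Integration.integral_cong) (auto simp: h_def)
    ultimately show ?case using elim by simp
  qed
  ultimately show ?thesis
    by (simp add: set_lebesgue_integral_def tendsto_cong)
qed

subsection \<open>Binomial terms and their Poisson limit\<close>

text \<open>The general term in the expansion of \<open>(x + y) ^ n\<close>, with weights that need
  not sum to 1: the missing mass belongs to weakening and fatal shocks. For \<open>k > n\<close> the
  binomial coefficient is 0, so the truncated exponent does no harm.\<close>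

definition binomial_term :: "nat \<Rightarrow> real \<Rightarrow> real \<Rightarrow> nat \<Rightarrow> real" where
  "binomial_term k x y n = real (n choose k) * x ^ k * y ^ (n - k)"

lemma binomial_term_nonneg: "x \<ge> 0 \<Longrightarrow> y \<ge> 0 \<Longrightarrow> binomial_term k x y n \<ge> 0"
  by (simp add: binomial_term_def)

lemma binomial_term_0 [simp]: "binomial_term k x y 0 = of_bool (k = 0)"
  by (cases k) (simp_all add: binomial_term_def)

lemma binomial_term_Suc_0: "binomial_term 0 x y (Suc n) = y * binomial_term 0 x y n"
  by (simp add: binomial_term_def)

lemma binomial_term_Suc_Suc:
  "binomial_term (Suc k) x y (Suc n) = y * binomial_term (Suc k) x y n + x * binomial_term k x y n"
proof (cases "Suc k \<le> n")
  case True
  then have "y ^ (n - k) = y * y ^ (n - Suc k)"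
    by (metis Suc_diff_le diff_Suc_Suc power_Suc)
  then show ?thesis by (simp add: binomial_term_def algebra_simps)
next
  case False
  then show ?thesis by (simp add: binomial_term_def binomial_eq_0)
qed

lemma binomial_term_le_power:
  assumes "x \<ge> 0" "y \<ge> 0"
  shows "binomial_term k x y n \<le> (x + y) ^ n"
proof (cases "k \<le> n")
  case True
  have "binomial_term k x y n \<le> (\<Sum>k\<le>n. binomial_term k x y n)"
    using True assms by (intro member_le_sum) (auto simp: binomial_term_nonneg)
  then show ?thesis by (simp add: binomial_ring binomial_term_def)
next
  case False
  then show ?thesis using assms by (simp add: binomial_term_def binomial_eq_0)
qed

text \<open>Follows from \<open>n choose k \<le> n ^ k\<close>. With \<open>n * x\<close> bounded,
  this gives the integrable majorants of the limit proofs.\<close>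

lemma binomial_term_le:
  assumes "x \<ge> 0" "y \<ge> 0"
  shows "binomial_term k x y n \<le> (real n * x) ^ k * y ^ (n - k)"
proof -
  have "real (n choose k) \<le> real n ^ k"
    by (cases "k \<le> n") (metis binomial_le_pow of_nat_le_iff of_nat_power, simp add: binomial_eq_0)
  then show ?thesis using assms
    by (auto simp: binomial_term_def power_mult_distrib intro!: mult_right_mono)
qed

lemma scale_binomial_term: "c ^ k * binomial_term k x y n = binomial_term k (c * x) y n"
  by (simp add: binomial_term_def power_mult_distrib)

lemma one_minus_power_le_exp:
  fixes p :: real
  assumes "0 \<le> p" "p \<le> 1"
  shows "(1 - p) ^ n \<le> exp (- (real n * p))"
proof -
  have "(1 - p) ^ n \<le> exp (- p) ^ n"
    using assms exp_ge_add_one_self[of "- p"] by (intro power_mono) auto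
  then show ?thesis by (simp add: exp_of_nat_mult[symmetric])
qed

text \<open>Poisson limit theorem. The rates of \<open>x\<close> and \<open>r\<close> relative to
  \<open>p\<close> are kept separate because \<open>x + (1 - r)\<close> may differ from 1.\<close>

lemma binomial_term_tendsto:
  fixes N :: "'a \<Rightarrow> nat" and p x r :: "'a \<Rightarrow> real"
  assumes N: "((\<lambda>t. real (N t) * p t) \<longlongrightarrow> s) F"
    and p: "\<forall>\<^sub>F t in F. p t > 0" and p0: "(p \<longlongrightarrow> 0) F"
    and x: "((\<lambda>t. x t / p t) \<longlongrightarrow> \<xi>) F"
    and r: "((\<lambda>t. r t / p t) \<longlongrightarrow> \<rho>) F" and r_pos: "\<forall>\<^sub>F t in F. r t > 0"
  shows "((\<lambda>t. binomial_term k (x t) (1 - r t) (N t)) \<longlongrightarrow> (s * \<xi>) ^ k / fact k * exp (- (s * \<rho>))) F"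
proof -
  have x0: "(x \<longlongrightarrow> 0) F"
  proof (rule Lim_transform_eventually)
    show "((\<lambda>t. x t / p t * p t) \<longlongrightarrow> 0) F" using tendsto_mult[OF x p0] by simp
    show "\<forall>\<^sub>F t in F. x t / p t * p t = x t" using p by eventually_elim simp
  qed
  have r0: "(r \<longlongrightarrow> 0) F"
  proof (rule Lim_transform_eventually)
    show "((\<lambda>t. r t / p t * p t) \<longlongrightarrow> 0) F" using tendsto_mult[OF r p0] by simp
    show "\<forall>\<^sub>F t in F. r t / p t * p t = r t" using p by eventually_elim simp
  qed
  have Nx: "((\<lambda>t. real (N t) * x t) \<longlongrightarrow> s * \<xi>) F"
    by (rule Lim_transform_eventually[OF tendsto_mult[OF N x]])
       (use p in eventually_elim, simp)
  have Nr: "((\<lambda>t. real (N t) * r t) \<longlongrightarrow> s * \<rho>) F"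
    by (rule Lim_transform_eventually[OF tendsto_mult[OF N r]])
       (use p in eventually_elim, simp)
  have choose: "((\<lambda>t. real (N t choose k) * x t ^ k) \<longlongrightarrow> (s * \<xi>) ^ k / fact k) F"
  proof -
    \<comment> \<open>The falling factorial has \<open>k\<close> factors; each absorbs one
      \<open>x t\<close>, and the correction \<open>i * x t\<close> tends to 0.\<close>
    have "real (N t choose k) * x t ^ k = (\<Prod>i = 0..<k. real (N t) * x t - real i * x t) / fact k" for t
      by (simp add: binomial_gbinomial gbinomial_prod_rev left_diff_distrib[symmetric] prod.distrib)
    moreover have "((\<lambda>t. (\<Prod>i = 0..<k. real (N t) * x t - real i * x t) / fact k) \<longlongrightarrow>
        (\<Prod>i = 0..<k. s * \<xi> - real i * 0) / fact k) F"
      by (intro tendsto_intros Nx x0) simp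
    ultimately show ?thesis by simp
  qed
  \<comment> \<open>Shortening the exponent by \<open>k\<close> changes the product by at most
    \<open>k * r t\<close>, also where the subtraction truncates.\<close>
  have diff: "((\<lambda>t. real (N t - k) * r t) \<longlongrightarrow> s * \<rho>) F"
  proof (rule tendsto_sandwich)
    show "\<forall>\<^sub>F t in F. real (N t) * r t - real k * r t \<le> real (N t - k) * r t"
      using r_pos by eventually_elim (simp add: left_diff_distrib[symmetric])
    show "\<forall>\<^sub>F t in F. real (N t - k) * r t \<le> real (N t) * r t"
      using r_pos by eventually_elim simp
    show "((\<lambda>t. real (N t) * r t - real k * r t) \<longlongrightarrow> s * \<rho>) F"
      using tendsto_diff[OF Nr tendsto_mult[OF tendsto_const r0, of "real k"]] by simp
  qed (rule Nr)
  \<comment> \<open>The quotient is the difference quotient of \<open>ln (1 - h)\<close> at 0.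
    Composed with \<open>r\<close>, it yields the limit of the power written as \<open>exp\<close>
    of a multiple of \<open>ln (1 - r t)\<close>.\<close>
  have "((\<lambda>h. ln (1 - h) / h) \<longlongrightarrow> - 1) (at (0::real))"
  proof -
    have "((\<lambda>h. ln (1 - h)) has_real_derivative - 1) (at 0)"
      by (auto intro!: derivative_eq_intros)
    then show ?thesis by (simp add: DERIV_def)
  qed
  moreover have "filterlim r (at 0) F"
    using r0 r_pos by (auto simp: filterlim_at elim: eventually_mono)
  ultimately have "((\<lambda>t. ln (1 - r t) / r t) \<longlongrightarrow> - 1) F"
    by (rule filterlim_compose)
  from tendsto_mult[OF diff this]
  have "((\<lambda>t. exp (real (N t - k) * r t * (ln (1 - r t) / r t))) \<longlongrightarrow> exp (s * \<rho> * - 1)) F"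
    by (rule tendsto_exp)
  moreover have "\<forall>\<^sub>F t in F. exp (real (N t - k) * r t * (ln (1 - r t) / r t)) = (1 - r t) ^ (N t - k)"
    using r_pos order_tendstoD(2)[OF r0, of 1, simplified]
    by eventually_elim (simp add: exp_of_nat_mult)
  ultimately have "((\<lambda>t. (1 - r t) ^ (N t - k)) \<longlongrightarrow> exp (- (s * \<rho>))) F"
    by (simp add: tendsto_cong)
  from tendsto_mult[OF choose this] show ?thesis
    by (simp add: binomial_term_def)
qed

text \<open>A multiple of a gamma integrand; it serves as majorant in both final limits.\<close>

lemma set_integrable_power_times_exp: "set_integrable lborel {0..} (\<lambda>u::real. C * (u ^ k * exp (- u)))"
proof -
  have "integrable lborel (\<lambda>u::real. indicator {0..} u * (u ^ k * exp (- u)))"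
  proof (rule integrableI_nonneg)
    show "(\<integral>\<^sup>+u. ennreal (indicator {0..} u * (u ^ k * exp (- u))) \<partial>lborel) < \<infinity>"
    proof -
      have "(\<integral>\<^sup>+u. ennreal (indicator {0..} u * (u ^ k * exp (- u))) \<partial>lborel) =
          (\<integral>\<^sup>+u. ennreal (u ^ k * exp (- u)) * indicator {0..} u \<partial>lborel)"
        by (intro nn_integral_cong) (auto simp: indicator_def)
      then show ?thesis by (simp add: nn_intergal_power_times_exp_Ici)
    qed
  qed (auto simp: indicator_def)
  then have "set_integrable lborel {0..} (\<lambda>u::real. u ^ k * exp (- u))"
    by (simp add: set_integrable_def)
  then show ?thesis by (rule set_integrable_mult_right)
qed

subsection \<open>The law of the shock counts\<close>

text \<open>The state before shock \<open>n\<close> looks only at earlier shocks; independence from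
  shock \<open>n\<close> rests on this. The two counts refer to each other, so they are handled in
  one strong induction.\<close>

lemma N_cong:
  assumes "\<And>i. 1 \<le> i \<Longrightarrow> i < n \<Longrightarrow> x i = y i"
  shows "N_plus \<alpha> \<beta> \<gamma> b c x n = N_plus \<alpha> \<beta> \<gamma> b c y n \<and> N_minus \<alpha> \<beta> \<gamma> b c x n = N_minus \<alpha> \<beta> \<gamma> b c y n"
  using assms
proof (induction n rule: less_induct)
  case (less n)
  have "N_plus \<alpha> \<beta> \<gamma> b c x i = N_plus \<alpha> \<beta> \<gamma> b c y i \<and> N_minus \<alpha> \<beta> \<gamma> b c x i = N_minus \<alpha> \<beta> \<gamma> b c y i"
    if "i < n" for i
    using less that by auto
  then show ?case
    using less.prems by (auto simp: N_plus.simps[of _ _ _ _ _ _ n] N_minus.simps[of _ _ _ _ _ _ n] intro!: sum.cong)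
qed

lemma N_Suc_0 [simp]: "N_plus \<alpha> \<beta> \<gamma> b c x (Suc 0) = 0" "N_minus \<alpha> \<beta> \<gamma> b c x (Suc 0) = 0"
  by (simp_all add: N_plus.simps[of _ _ _ _ _ _ "Suc 0"] N_minus.simps[of _ _ _ _ _ _ "Suc 0"])

lemma N_Suc:
  assumes "n \<ge> 1"
  shows "N_plus \<alpha> \<beta> \<gamma> b c x (Suc n) = N_plus \<alpha> \<beta> \<gamma> b c x n
           + of_bool (x n \<in> {\<gamma>..<\<beta>} \<and> N_minus \<alpha> \<beta> \<gamma> b c x n = 0)"
    and "N_minus \<alpha> \<beta> \<gamma> b c x (Suc n) = N_minus \<alpha> \<beta> \<gamma> b c x n
           + of_bool (x n \<in> {\<beta>..<\<alpha> + b (N_plus \<alpha> \<beta> \<gamma> b c x n) - c (N_minus \<alpha> \<beta> \<gamma> b c x n)})"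
  using assms
  by (simp_all add: N_plus.simps[of _ _ _ _ _ _ "Suc n"] N_plus.simps[of _ _ _ _ _ _ n]
      N_minus.simps[of _ _ _ _ _ _ "Suc n"] N_minus.simps[of _ _ _ _ _ _ n]
      atLeastLessThanSuc add.commute del: of_bool_conj)

text \<open>\<open>survives \<dots> x n k l\<close> only concerns the shocks \<open>1, \<dots>, n - 1\<close>: none of them is fatal, and they
  lead to the state \<open>(k, l)\<close>.\<close>

definition survives ::
  "real \<Rightarrow> real \<Rightarrow> real \<Rightarrow> (nat \<Rightarrow> real) \<Rightarrow> (nat \<Rightarrow> real) \<Rightarrow> (nat \<Rightarrow> real) \<Rightarrow> nat \<Rightarrow> nat \<Rightarrow> nat \<Rightarrow> bool"
where
  "survives \<alpha> \<beta> \<gamma> b c x n k l \<longleftrightarrow>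
     (\<forall>i\<in>{1..<n}. x i < \<alpha> + b (N_plus \<alpha> \<beta> \<gamma> b c x i) - c (N_minus \<alpha> \<beta> \<gamma> b c x i)) \<and>
     N_plus \<alpha> \<beta> \<gamma> b c x n = k \<and> N_minus \<alpha> \<beta> \<gamma> b c x n = l"

lemma survives_cong:
  assumes "\<And>i. 1 \<le> i \<Longrightarrow> i < n \<Longrightarrow> x i = y i"
  shows "survives \<alpha> \<beta> \<gamma> b c x n k l \<longleftrightarrow> survives \<alpha> \<beta> \<gamma> b c y n k l"
proof -
  have "N_plus \<alpha> \<beta> \<gamma> b c x i = N_plus \<alpha> \<beta> \<gamma> b c y i \<and> N_minus \<alpha> \<beta> \<gamma> b c x i = N_minus \<alpha> \<beta> \<gamma> b c y i"
    if "i \<le> n" for i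
    by (rule N_cong) (use assms that in auto)
  then show ?thesis using assms by (auto simp: survives_def)
qed

text \<open>The infimum of the empty set is infinite, so a finite infimum is attained, and it is a
  first passage time. Once the state at time \<open>n\<close> is known to be \<open>(k, l)\<close>,
  the threshold in force there is explicit.\<close>

lemma fatal_index_eq_enat_iff:
  "fatal_index \<alpha> \<beta> \<gamma> b c x = enat n \<and> N_plus \<alpha> \<beta> \<gamma> b c x n = k \<and> N_minus \<alpha> \<beta> \<gamma> b c x n = l \<longleftrightarrow>
   n \<ge> 1 \<and> survives \<alpha> \<beta> \<gamma> b c x n k l \<and> x n \<ge> \<alpha> + b k - c l"
proof -
  define Q where "Q i \<longleftrightarrow> 1 \<le> i \<and> x i \<ge> \<alpha> + b (N_plus \<alpha> \<beta> \<gamma> b c x i) - c (N_minus \<alpha> \<beta> \<gamma> b c x i)" for i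
  have "Inf {enat i |i. Q i} = enat n \<longleftrightarrow> Q n \<and> (\<forall>i<n. \<not> Q i)"
  proof
    assume *: "Inf {enat i |i. Q i} = enat n"
    then have "{enat i |i. Q i} \<noteq> {}"
      by (metis Inf_enat_def enat.distinct(1))
    then have "Inf {enat i |i. Q i} \<in> {enat i |i. Q i}"
      unfolding Inf_enat_def by (auto intro: LeastI)
    moreover have "enat n \<le> enat i" if "Q i" for i
      unfolding *[symmetric] by (rule Inf_lower) (use that in auto)
    ultimately show "Q n \<and> (\<forall>i<n. \<not> Q i)"
      using * by force
  next
    assume *: "Q n \<and> (\<forall>i<n. \<not> Q i)"
    show "Inf {enat i |i. Q i} = enat n"
      using * by (intro Inf_eqI) (auto simp: not_less[symmetric])
  qed
  then show ?thesis
    unfolding fatal_index_def Q_def[symmetric]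
    by (auto simp: survives_def Q_def not_le)
qed

text \<open>Every threshold is at least \<open>\<beta>\<close>, so a shock below
  \<open>\<beta>\<close> is never fatal, and a surviving shock from \<open>\<beta>\<close> upwards
  would be weakening.\<close>

lemma survives_Suc_0:
  assumes "n \<ge> 1" "\<gamma> \<le> \<beta>" "\<And>k l. \<beta> \<le> \<alpha> + b k - c l"
  shows "survives \<alpha> \<beta> \<gamma> b c x (Suc n) k 0 \<longleftrightarrow>
    survives \<alpha> \<beta> \<gamma> b c x n k 0 \<and> x n < \<gamma> \<or>
    (\<exists>j. k = Suc j \<and> survives \<alpha> \<beta> \<gamma> b c x n j 0 \<and> x n \<in> {\<gamma>..<\<beta>})"
  using assms(1,2) assms(3)[of "N_plus \<alpha> \<beta> \<gamma> b c x n" "N_minus \<alpha> \<beta> \<gamma> b c x n"]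
  by (auto simp: survives_def N_Suc atLeastLessThanSuc)

text \<open>After the first weakening shock strengthening has stopped, so every shock below
  \<open>\<beta>\<close> leaves the state alone and \<open>k\<close> is frozen.\<close>

lemma survives_Suc_Suc:
  assumes "n \<ge> 1" "\<gamma> \<le> \<beta>" "\<And>k l. \<beta> \<le> \<alpha> + b k - c l"
  shows "survives \<alpha> \<beta> \<gamma> b c x (Suc n) k (Suc l) \<longleftrightarrow>
    survives \<alpha> \<beta> \<gamma> b c x n k (Suc l) \<and> x n < \<beta> \<or>
    survives \<alpha> \<beta> \<gamma> b c x n k l \<and> x n \<in> {\<beta>..<\<alpha> + b k - c l}"
  using assms(1,2) assms(3)[of "N_plus \<alpha> \<beta> \<gamma> b c x n" "N_minus \<alpha> \<beta> \<gamma> b c x n"]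
  by (auto simp: survives_def N_Suc atLeastLessThanSuc)

text \<open>The index set \<open>I\<close> stays fixed while \<open>n\<close> grows, so the
  inclusion is a premise of the inductive claim.\<close>

lemma N_measurable:
  fixes b c :: "nat \<Rightarrow> real"
  assumes "1 \<le> n"
  shows "{1..<n} \<subseteq> I \<Longrightarrow> (\<lambda>x. N_plus \<alpha> \<beta> \<gamma> b c x n) \<in> measurable (PiM I (\<lambda>_. borel)) (count_space UNIV) \<and>
    (\<lambda>x. N_minus \<alpha> \<beta> \<gamma> b c x n) \<in> measurable (PiM I (\<lambda>_. borel)) (count_space UNIV)"
  using assms
proof (induction n rule: dec_induct)
  case base
  then show ?case by simp
next
  case (step n)
  have I: "n \<in> I" using step by auto
  have "{1..<n} \<subseteq> I" using step.prems by auto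
  from step.IH[OF this]
  have [measurable]: "(\<lambda>x. N_plus \<alpha> \<beta> \<gamma> b c x n) \<in> measurable (PiM I (\<lambda>_. borel)) (count_space UNIV)"
    "(\<lambda>x. N_minus \<alpha> \<beta> \<gamma> b c x n) \<in> measurable (PiM I (\<lambda>_. borel)) (count_space UNIV)"
    by simp_all
  have [measurable]: "(\<lambda>x. x n) \<in> borel_measurable (PiM I (\<lambda>_. borel :: real measure))"
    using I by simp
  show ?case
    using step(1) by (auto simp: N_Suc of_bool_def simp del: of_bool_conj)
qed

section \<open>Exact law of the state for one fixed parameter \<open>t\<close>\<close>

locale shock_model = prob_space +
  fixes X :: "nat \<Rightarrow> 'a \<Rightarrow> real" and \<alpha> \<beta> \<gamma> :: real and b c :: "nat \<Rightarrow> real"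
  assumes indep: "indep_vars (\<lambda>_. borel) X {1..}"
    and ident: "\<And>i. i \<ge> 1 \<Longrightarrow> distr M borel (X i) = distr M borel (X 1)"
    and order: "\<gamma> \<le> \<beta>"
    and threshold: "\<And>k l. \<beta> \<le> \<alpha> + b k - c l"
begin

text \<open>Shifted by one, so that \<open>n\<close> is the number of shocks survived.\<close>

definition survive_prob :: "nat \<Rightarrow> nat \<Rightarrow> nat \<Rightarrow> real" where
  "survive_prob n k l = prob {\<omega> \<in> space M. survives \<alpha> \<beta> \<gamma> b c (\<lambda>i. X i \<omega>) (Suc n) k l}"

lemma X_measurable [measurable]: "i \<ge> 1 \<Longrightarrow> X i \<in> borel_measurable M"
  using indep by (auto simp: indep_vars_def)

lemma prob_X:
  assumes "i \<ge> 1" and [measurable]: "B \<in> sets borel"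
  shows "prob {\<omega> \<in> space M. X i \<omega> \<in> B} = prob {\<omega> \<in> space M. X 1 \<omega> \<in> B}"
proof -
  have "prob {\<omega> \<in> space M. X j \<omega> \<in> B} = measure (distr M borel (X j)) B" if "j \<ge> 1" for j
    using that by (subst measure_distr) (auto simp: vimage_def Int_def conj_commute)
  then show ?thesis using ident[OF assms(1)] assms(1) by simp
qed

lemma prob_less: "i \<ge> 1 \<Longrightarrow> prob {\<omega> \<in> space M. X i \<omega> < y} = 1 - tail M (X 1) y"
  using prob_X[of i "{..<y}"] by (simp add: tail_def left_cdf_def)

lemma prob_ge: "i \<ge> 1 \<Longrightarrow> prob {\<omega> \<in> space M. y \<le> X i \<omega>} = tail M (X 1) y"
  using prob_less[of i y] prob_neg[of "\<lambda>\<omega>. X i \<omega> < y"] by (simp add: not_less)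

lemma prob_between:
  assumes "i \<ge> 1" "y \<le> y'"
  shows "prob {\<omega> \<in> space M. X i \<omega> \<in> {y..<y'}} = tail M (X 1) y - tail M (X 1) y'"
proof -
  have "{\<omega> \<in> space M. X i \<omega> \<in> {y..<y'}} = {\<omega> \<in> space M. X i \<omega> < y'} - {\<omega> \<in> space M. X i \<omega> < y}"
    by auto
  moreover have "prob \<dots> = prob {\<omega> \<in> space M. X i \<omega> < y'} - prob {\<omega> \<in> space M. X i \<omega> < y}"
    using assms by (intro finite_measure_Diff) auto
  ultimately show ?thesis using assms by (simp add: prob_less)
qed

text \<open>Exhibits survival as a property of the finite block before \<open>n\<close>, the form to
  which product measurability and independence of blocks apply.\<close>

lemma survives_restrict:
  "survives \<alpha> \<beta> \<gamma> b c (\<lambda>i. X i \<omega>) n k l \<longleftrightarrow>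
   survives \<alpha> \<beta> \<gamma> b c (restrict (\<lambda>i. X i \<omega>) {1..<n}) n k l"
  by (rule survives_cong) auto

lemma sets_survives [measurable]:
  "n \<ge> 1 \<Longrightarrow> {x \<in> space (PiM {1..<n} (\<lambda>_. borel)). survives \<alpha> \<beta> \<gamma> b c x n k l} \<in> sets (PiM {1..<n} (\<lambda>_. borel))"
proof -
  assume n: "n \<ge> 1"
  have [measurable]: "(\<lambda>x. N_plus \<alpha> \<beta> \<gamma> b c x i) \<in> measurable (PiM {1..<n} (\<lambda>_. borel)) (count_space UNIV)"
    "(\<lambda>x. N_minus \<alpha> \<beta> \<gamma> b c x i) \<in> measurable (PiM {1..<n} (\<lambda>_. borel)) (count_space UNIV)"
    if "i \<in> {1..n}" for i
    using N_measurable[of i "{1..<n}"] that by auto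
  have [measurable]: "n \<in> {1..n}" using n by simp
  have [measurable_dest]: "i \<in> {1..<n} \<Longrightarrow> i \<in> {1..n}" for i by simp
  show ?thesis
    unfolding survives_def by measurable
qed

lemma events_survives [measurable]:
  assumes "n \<ge> 1"
  shows "{\<omega> \<in> space M. survives \<alpha> \<beta> \<gamma> b c (\<lambda>i. X i \<omega>) n k l} \<in> events"
proof -
  have "(\<lambda>\<omega>. restrict (\<lambda>i. X i \<omega>) {1..<n}) \<in> measurable M (PiM {1..<n} (\<lambda>_. borel))"
    by (intro measurable_restrict) auto
  from measurable_sets[OF this sets_survives[OF assms, of k l]]
  show ?thesis
    by (subst survives_restrict) (auto simp: vimage_def Int_def space_PiM conj_commute)
qed

text \<open>The index blocks \<open>{1..<n}\<close> and \<open>{n}\<close> are disjoint, so the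
  corresponding restrictions of \<open>X\<close> are independent.\<close>

lemma prob_survives_inter:
  assumes n: "n \<ge> 1" and B: "B \<in> sets borel"
  shows "prob {\<omega> \<in> space M. survives \<alpha> \<beta> \<gamma> b c (\<lambda>i. X i \<omega>) n k l \<and> X n \<omega> \<in> B} =
    prob {\<omega> \<in> space M. survives \<alpha> \<beta> \<gamma> b c (\<lambda>i. X i \<omega>) n k l} * prob {\<omega> \<in> space M. X n \<omega> \<in> B}"
proof -
  let ?E = "{x \<in> space (PiM {1..<n} (\<lambda>_. borel)). survives \<alpha> \<beta> \<gamma> b c x n k l}"
  let ?B = "{x \<in> space (PiM {n} (\<lambda>_. borel)). x n \<in> B}"
  have B': "?B \<in> sets (PiM {n} (\<lambda>_. borel))"
    using B by measurable
  have "indep_var (PiM {1..<n} (\<lambda>_. borel)) (\<lambda>\<omega>. restrict (\<lambda>i. X i \<omega>) {1..<n})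
      (PiM {n} (\<lambda>_. borel)) (\<lambda>\<omega>. restrict (\<lambda>i. X i \<omega>) {n})"
    by (rule indep_var_restrict[OF indep]) (use n in auto)
  from indep_varD[OF this sets_survives[OF n, of k l] B'] show ?thesis
    unfolding survives_restrict[of _ n]
    by (auto simp: vimage_def Int_def space_PiM conj_commute conj_left_commute)
qed

lemma survive_prob_0: "survive_prob 0 k l = of_bool (k = 0 \<and> l = 0)"
  by (auto simp: survive_prob_def survives_def prob_space)

text \<open>One step of the chain before weakening: the ways of arriving given by
  \<open>survives_Suc_0\<close> are disjoint, and each factorizes by independence.\<close>

lemma survive_prob_Suc_0:
  "survive_prob (Suc n) k 0 = (1 - tail M (X 1) \<gamma>) * survive_prob n k 0 +
    (case k of 0 \<Rightarrow> 0 | Suc j \<Rightarrow> (tail M (X 1) \<gamma> - tail M (X 1) \<beta>) * survive_prob n j 0)"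
proof -
  let ?S = "\<lambda>k \<omega>. survives \<alpha> \<beta> \<gamma> b c (\<lambda>i. X i \<omega>) (Suc n) k 0"
  have 1: "prob {\<omega> \<in> space M. ?S k \<omega> \<and> X (Suc n) \<omega> < \<gamma>} = survive_prob n k 0 * (1 - tail M (X 1) \<gamma>)"
    using prob_survives_inter[of "Suc n" "{..<\<gamma>}" k 0] by (simp add: prob_less survive_prob_def)
  have 2: "prob {\<omega> \<in> space M. ?S j \<omega> \<and> X (Suc n) \<omega> \<in> {\<gamma>..<\<beta>}} =
      survive_prob n j 0 * (tail M (X 1) \<gamma> - tail M (X 1) \<beta>)" for j
    using prob_survives_inter[of "Suc n" "{\<gamma>..<\<beta>}" j 0] prob_between[of "Suc n" \<gamma> \<beta>] order
    by (simp add: survive_prob_def)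
  show ?thesis
  proof (cases k)
    case 0
    then have "survive_prob (Suc n) k 0 = prob {\<omega> \<in> space M. ?S k \<omega> \<and> X (Suc n) \<omega> < \<gamma>}"
      by (simp add: survive_prob_def survives_Suc_0 order threshold)
    then show ?thesis using 0 1 by simp
  next
    case (Suc j)
    then have "survive_prob (Suc n) k 0 = prob ({\<omega> \<in> space M. ?S k \<omega> \<and> X (Suc n) \<omega> < \<gamma>} \<union>
        {\<omega> \<in> space M. ?S j \<omega> \<and> X (Suc n) \<omega> \<in> {\<gamma>..<\<beta>}})"
      unfolding survive_prob_def
      by (intro arg_cong[where f = prob]) (auto simp: survives_Suc_0 order threshold)
    also have "\<dots> = prob {\<omega> \<in> space M. ?S k \<omega> \<and> X (Suc n) \<omega> < \<gamma>} +
        prob {\<omega> \<in> space M. ?S j \<omega> \<and> X (Suc n) \<omega> \<in> {\<gamma>..<\<beta>}}"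
      by (rule finite_measure_Union) auto
    finally show ?thesis using Suc 1 2 by simp
  qed
qed

text \<open>One step of the chain into a weakened state. The weight of staying is
  \<open>1 - tail M (X 1) \<beta>\<close>, since shocks in \<open>[\<gamma>, \<beta>)\<close> no
  longer count.\<close>

lemma survive_prob_Suc_Suc:
  "survive_prob (Suc n) k (Suc l) = (1 - tail M (X 1) \<beta>) * survive_prob n k (Suc l) +
    (tail M (X 1) \<beta> - tail M (X 1) (\<alpha> + b k - c l)) * survive_prob n k l"
proof -
  let ?S = "\<lambda>l \<omega>. survives \<alpha> \<beta> \<gamma> b c (\<lambda>i. X i \<omega>) (Suc n) k l"
  have "survive_prob (Suc n) k (Suc l) = prob ({\<omega> \<in> space M. ?S (Suc l) \<omega> \<and> X (Suc n) \<omega> < \<beta>} \<union>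
      {\<omega> \<in> space M. ?S l \<omega> \<and> X (Suc n) \<omega> \<in> {\<beta>..<\<alpha> + b k - c l}})"
    unfolding survive_prob_def
    by (intro arg_cong[where f = prob]) (auto simp: survives_Suc_Suc order threshold)
  also have "\<dots> = prob {\<omega> \<in> space M. ?S (Suc l) \<omega> \<and> X (Suc n) \<omega> < \<beta>} +
      prob {\<omega> \<in> space M. ?S l \<omega> \<and> X (Suc n) \<omega> \<in> {\<beta>..<\<alpha> + b k - c l}}"
    by (rule finite_measure_Union) auto
  finally show ?thesis
    using prob_survives_inter[of "Suc n" "{..<\<beta>}" k "Suc l"]
      prob_survives_inter[of "Suc n" "{\<beta>..<\<alpha> + b k - c l}" k l]
      prob_between[of "Suc n" \<beta> "\<alpha> + b k - c l"] threshold[of k l]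
    by (simp add: prob_less survive_prob_def)
qed

lemma survive_prob_eq_0:
  "survive_prob n k 0 = binomial_term k (tail M (X 1) \<gamma> - tail M (X 1) \<beta>) (1 - tail M (X 1) \<gamma>) n"
proof (induction n arbitrary: k)
  case 0
  then show ?case by (simp add: survive_prob_0)
next
  case (Suc n)
  then show ?case
    by (cases k) (simp_all add: survive_prob_Suc_0 binomial_term_Suc_0 binomial_term_Suc_Suc)
qed

text \<open>The summation index \<open>m\<close> is the number of shocks before the first weakening one.\<close>

lemma survive_prob_eq_Suc:
  "survive_prob n k (Suc l) =
    (\<Prod>h = 0..l. tail M (X 1) \<beta> - tail M (X 1) (\<alpha> + b k - c h)) *
    (\<Sum>m<n. binomial_term k (tail M (X 1) \<gamma> - tail M (X 1) \<beta>) (1 - tail M (X 1) \<gamma>) m *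
      binomial_term l 1 (1 - tail M (X 1) \<beta>) (n - Suc m))"
proof (induction n arbitrary: l)
  case 0
  then show ?case by (simp add: survive_prob_0)
next
  case (Suc n)
  let ?p = "tail M (X 1) \<beta>"
  let ?A = "binomial_term k (tail M (X 1) \<gamma> - ?p) (1 - tail M (X 1) \<gamma>)"
  let ?B = "\<lambda>l. binomial_term l 1 (1 - ?p)"
  have diff: "n - m = Suc (n - Suc m)" if "m \<in> {..<n}" for m
    using that by auto
  let ?d = "\<lambda>h. ?p - tail M (X 1) (\<alpha> + b k - c h)"
  let ?S = "\<lambda>l n. \<Sum>m<n. ?A m * ?B l (n - Suc m)"
  have IH: "survive_prob n k (Suc l) = (\<Prod>h = 0..l. ?d h) * ?S l n" for l
    by (rule Suc.IH)
  show ?case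
  proof (cases l)
    case 0
    \<comment> \<open>The inflow comes from the state without weakening: the new summand
      \<open>m = n\<close> contains \<open>?B 0 0 = 1\<close> and contributes
      \<open>?A n\<close>.\<close>
    have S: "?S 0 (Suc n) = (1 - ?p) * ?S 0 n + ?A n"
      unfolding sum.lessThan_Suc sum_distrib_left diff_Suc_Suc
      by (intro arg_cong2[where f = "(+)"] sum.cong refl) (simp_all add: diff binomial_term_Suc_0)
    have "survive_prob (Suc n) k (Suc 0) = (1 - ?p) * (?d 0 * ?S 0 n) + ?d 0 * ?A n"
      unfolding survive_prob_Suc_Suc IH survive_prob_eq_0 by simp
    also have "\<dots> = ?d 0 * ?S 0 (Suc n)"
      unfolding S by (simp only: ring_distribs mult_ac)
    finally show ?thesis using 0 by simp
  next
    case (Suc j)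
    \<comment> \<open>Now the new summand vanishes, as \<open>?B (Suc j) 0 = 0\<close>. Pascal's
      rule with weight 1 splits the others and produces the inflow \<open>?S j n\<close>.\<close>
    have S: "?S (Suc j) (Suc n) = (1 - ?p) * ?S (Suc j) n + ?S j n"
      unfolding sum.lessThan_Suc sum_distrib_left diff_Suc_Suc sum.distrib[symmetric]
      by (simp add: diff binomial_term_Suc_Suc algebra_simps cong: sum.cong_simp)
    have "survive_prob (Suc n) k (Suc (Suc j)) =
        (1 - ?p) * ((\<Prod>h = 0..Suc j. ?d h) * ?S (Suc j) n) + ?d (Suc j) * ((\<Prod>h = 0..j. ?d h) * ?S j n)"
      unfolding survive_prob_Suc_Suc IH by (rule refl)
    also have "\<dots> = (\<Prod>h = 0..Suc j. ?d h) * ?S (Suc j) (Suc n)"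
      unfolding S by (simp add: algebra_simps)
    finally show ?thesis using Suc by simp
  qed
qed

text \<open>The event is partitioned by the fatal index \<open>Suc n\<close>: survival of
  \<open>n\<close> shocks with state \<open>(k, l)\<close>, followed by an independent shock above
  the threshold of that state.\<close>

lemma shock_event_sums:
  "(\<lambda>n. if real (Suc n) \<ge> s then survive_prob n k l * tail M (X 1) (\<alpha> + b k - c l) else 0)
     sums prob (shock_event M X \<alpha> \<beta> \<gamma> b c s k l)"
proof -
  define A where "A n = {\<omega> \<in> space M. real (Suc n) \<ge> s \<and>
    survives \<alpha> \<beta> \<gamma> b c (\<lambda>i. X i \<omega>) (Suc n) k l \<and> X (Suc n) \<omega> \<in> {\<alpha> + b k - c l..}}" for n
  have event: "shock_event M X \<alpha> \<beta> \<gamma> b c s k l = (\<Union>n. A n)"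
  proof -
    have "shock_event M X \<alpha> \<beta> \<gamma> b c s k l = {\<omega> \<in> space M. \<exists>n\<ge>1. real n \<ge> s \<and>
        survives \<alpha> \<beta> \<gamma> b c (\<lambda>i. X i \<omega>) n k l \<and> X n \<omega> \<ge> \<alpha> + b k - c l}"
      unfolding shock_event_def using fatal_index_eq_enat_iff by blast
    also have "\<dots> = (\<Union>n. A n)"
      by (auto simp: A_def) (metis Suc_le_D One_nat_def of_nat_Suc)+
    finally show ?thesis .
  qed
  have disj: "disjoint_family A"
  proof (unfold disjoint_family_on_def, intro ballI impI, rule ccontr)
    fix m n assume "m \<noteq> n" "A m \<inter> A n \<noteq> {}"
    then obtain \<omega> where \<omega>: "\<omega> \<in> A m" "\<omega> \<in> A n" by auto
    have "fatal_index \<alpha> \<beta> \<gamma> b c (\<lambda>i. X i \<omega>) = enat (Suc n)" if "\<omega> \<in> A n" for n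
      using that fatal_index_eq_enat_iff[of \<alpha> \<beta> \<gamma> b c "\<lambda>i. X i \<omega>" "Suc n" k l] by (auto simp: A_def)
    from this[OF \<omega>(1)] this[OF \<omega>(2)] show False using \<open>m \<noteq> n\<close> by simp
  qed
  have meas: "A n \<in> events" for n
    unfolding A_def by measurable auto
  have "prob (A n) = (if real (Suc n) \<ge> s then survive_prob n k l * tail M (X 1) (\<alpha> + b k - c l) else 0)" for n
    using prob_survives_inter[of "Suc n" "{\<alpha> + b k - c l..}" k l]
    by (auto simp: A_def survive_prob_def prob_ge)
  then show ?thesis
    using finite_measure_UNION[OF _ disj] meas event by (auto simp: image_subset_iff)
qed

end

subsection \<open>Limits\<close>

text \<open>Rounding down and the shift by \<open>j\<close> together cost at most
  \<open>Suc j\<close> steps of width \<open>p \<le> 1\<close>; the factor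
  \<open>exp (real (Suc j))\<close> pays for them uniformly in \<open>p\<close>.\<close>

lemma geometric_floor_bounds:
  fixes p u :: real
  assumes p: "0 < p" "p \<le> 1" and u: "u \<ge> 0"
  shows "real (nat \<lfloor>u / p\<rfloor>) * p \<le> u"
    and "(1 - p) ^ (nat \<lfloor>u / p\<rfloor> - j) \<le> exp (real (Suc j)) * exp (- u)"
proof -
  define n where "n = nat \<lfloor>u / p\<rfloor>"
  have n: "real n \<le> u / p" "u / p - 1 \<le> real n"
    using p u by (simp_all add: n_def)
  show "real (nat \<lfloor>u / p\<rfloor>) * p \<le> u"
    using n(1) p by (simp add: n_def[symmetric] pos_le_divide_eq)
  have "(u / p - real (Suc j)) * p \<le> real (n - j) * p"
    using n(2) p by (intro mult_right_mono) auto
  then have "u - real (Suc j) * p \<le> real (n - j) * p"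
    using p by (simp add: left_diff_distrib)
  moreover have "real (Suc j) * p \<le> real (Suc j)"
    using p by (intro mult_left_le) auto
  ultimately have "u - real (Suc j) \<le> real (n - j) * p"
    by linarith
  then have "exp (- (real (n - j) * p)) \<le> exp (real (Suc j)) * exp (- u)"
    unfolding exp_add[symmetric] by simp
  then show "(1 - p) ^ (nat \<lfloor>u / p\<rfloor> - j) \<le> exp (real (Suc j)) * exp (- u)"
    unfolding n_def[symmetric]
    using one_minus_power_le_exp[of p "n - j"] p by (meson less_imp_le order_trans)
qed

text \<open>With \<open>m\<close> near \<open>y * N t\<close>, the two factors have Poisson limits
  with time arguments \<open>u * y\<close> and \<open>u * (1 - y)\<close>. The sum divided by
  \<open>N t\<close> is a Riemann sum in \<open>y\<close>, and the remaining factor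
  \<open>N t * p t\<close> tends to \<open>u\<close>.\<close>

lemma binomial_convolution_tendsto:
  fixes N :: "real \<Rightarrow> nat" and p x r :: "real \<Rightarrow> real"
  assumes N: "((\<lambda>t. real (N t) * p t) \<longlongrightarrow> u) at_top" and u: "u > 0"
    and p: "\<And>t. p t > 0" "\<And>t. p t \<le> 1" and p0: "(p \<longlongrightarrow> 0) at_top"
    and x: "\<And>t. x t \<ge> 0" "((\<lambda>t. x t / p t) \<longlongrightarrow> \<xi>) at_top"
    and r: "\<And>t. x t \<le> r t" "\<And>t. 0 < r t" "\<And>t. r t \<le> 1" "((\<lambda>t. r t / p t) \<longlongrightarrow> \<rho>) at_top"
  shows "((\<lambda>t. p t * (\<Sum>m<N t. binomial_term k (x t) (1 - r t) m * binomial_term l (p t) (1 - p t) (N t - Suc m)))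
    \<longlongrightarrow> u * (LBINT y:{0..1}. (u * y * \<xi>) ^ k / fact k * exp (- (u * y * \<rho>)) *
          ((u * (1 - y)) ^ l / fact l * exp (- (u * (1 - y)))))) at_top"
proof -
  define A where "A t = binomial_term k (x t) (1 - r t)" for t
  define B where "B t = binomial_term l (p t) (1 - p t)" for t
  \<comment> \<open>Extended by 0 beyond the range of summation; the factor \<open>1 / N t\<close>
    is the step width, which \<open>sum_tendsto_integral\<close> divides out again.\<close>
  define f where "f t m = (if m < N t then A t m * B t (N t - Suc m) / real (N t) else 0)" for t m
  define h where "h y = (u * y * \<xi>) ^ k / fact k * exp (- (u * y * \<rho>)) *
    ((u * (1 - y)) ^ l / fact l * exp (- (u * (1 - y))))" for y
  have A: "0 \<le> A t m" "A t m \<le> 1" for t m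
  proof -
    show "0 \<le> A t m" using x r by (simp add: A_def binomial_term_nonneg)
    have "A t m \<le> (x t + (1 - r t)) ^ m"
      unfolding A_def using x r by (intro binomial_term_le_power) auto
    also have "\<dots> \<le> 1"
      using x(1)[of t] r(1,3)[of t] by (intro power_le_one) auto
    finally show "A t m \<le> 1" .
  qed
  have B: "0 \<le> B t m" "B t m \<le> 1" for t m
    using binomial_term_le_power[of "p t" "1 - p t" l m] p[of t]
    by (simp_all add: B_def binomial_term_nonneg)
  have p_nz: "p t \<noteq> 0" for t
    using p(1)[of t] by simp
  \<comment> \<open>As \<open>u > 0\<close>, the width \<open>1 / N t\<close> is eventually positive
    and not the default value of a division by 0.\<close>
  have N_pos: "\<forall>\<^sub>F t in at_top. N t > 0"
    using order_tendstoD(1)[OF N u] by eventually_elim (auto intro: gr0I)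
  have Ninv: "((\<lambda>t. 1 / real (N t)) \<longlongrightarrow> 0) at_top"
  proof (rule Lim_transform_eventually)
    show "((\<lambda>t. p t / (real (N t) * p t)) \<longlongrightarrow> 0) at_top"
      using tendsto_divide[OF p0 N] u by simp
    show "\<forall>\<^sub>F t in at_top. p t / (real (N t) * p t) = 1 / real (N t)"
      using p(1) by (simp add: p_nz)
  qed
  have "((\<lambda>t. \<Sum>m<N t. A t m * B t (N t - Suc m) / real (N t)) \<longlongrightarrow>
      (LBINT y:{0..}. indicator {..1} y * h y)) at_top"
  \<comment> \<open>With \<open>s = 0\<close> the cutoff always holds, so the integral starts at 0.
    Both factors are at most 1, which makes the indicator of the range a majorant.\<close>
  proof (rule sum_tendsto_integral[where p = "\<lambda>t. 1 / real (N t)" and s = "\<lambda>_. 0" and f = f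
        and w = "indicator {..1}"])
    show "\<forall>\<^sub>F t in at_top. 0 < 1 / real (N t)"
      using N_pos by eventually_elim simp
    show "\<forall>\<^sub>F t in at_top. \<forall>n. 0 \<le> f t n"
      using A B by (simp add: f_def)
    have "(\<lambda>n. if real (Suc n) \<ge> 0 then f t n else 0) sums (\<Sum>m<N t. f t m)" for t
    proof -
      have "f t sums (\<Sum>m<N t. f t m)"
        by (rule sums_finite) (auto simp: f_def)
      then show ?thesis by simp
    qed
    moreover have "(\<Sum>m<N t. f t m) = (\<Sum>m<N t. A t m * B t (N t - Suc m) / real (N t))" for t
      by (intro sum.cong refl) (simp add: f_def)
    ultimately show "\<forall>\<^sub>F t in at_top. (\<lambda>n. if real (Suc n) \<ge> 0 then f t n else 0) sums
        (\<Sum>m<N t. A t m * B t (N t - Suc m) / real (N t))"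
      by simp
    show "AE y in lborel. 0 < y \<longrightarrow>
        ((\<lambda>t. f t (nat \<lfloor>y / (1 / real (N t))\<rfloor>) / (1 / real (N t))) \<longlongrightarrow> indicator {..1} y * h y) at_top"
      \<comment> \<open>At \<open>y = 1\<close> the rounded index lies outside the range and
        \<open>f\<close> is 0, while the indicator of \<open>{..1}\<close> is 1.\<close>
      using AE_lborel_singleton[of 1]
    proof eventually_elim
      case (elim y)
      define m where "m t = nat \<lfloor>y / (1 / real (N t))\<rfloor>" for t
      show ?case
      proof (intro impI)
        assume y: "0 < y"
        show "((\<lambda>t. f t (nat \<lfloor>y / (1 / real (N t))\<rfloor>) / (1 / real (N t))) \<longlongrightarrow> indicator {..1} y * h y) at_top"
        proof (cases "y < 1")
          case False
          have "real (N t) \<le> y * real (N t)" for t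
            using False by (simp add: mult_le_cancel_right1)
          then have "N t \<le> m t" for t
            unfolding m_def by (simp add: le_nat_floor)
          then show ?thesis
            unfolding m_def[symmetric] using False elim by (simp add: f_def not_less[symmetric])
        next
          case True
          have "((\<lambda>t. real (m t) * (1 / real (N t))) \<longlongrightarrow> y) at_top"
            unfolding m_def using N_pos y
            by (intro floor_scaled_tendsto Ninv) (auto elim: eventually_mono)
          from tendsto_mult[OF this N]
          have m: "((\<lambda>t. real (m t) * p t) \<longlongrightarrow> y * u) at_top"
            by (rule Lim_transform_eventually)
               (use N_pos in \<open>auto elim!: eventually_mono simp: mult.commute\<close>)
          have less: "\<forall>\<^sub>F t in at_top. m t < N t"
            using N_pos
          proof eventually_elim
            case (elim t)
            then have "y * real (N t) < real (N t)" using True by simp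
            then show ?case unfolding m_def using y by (simp add: floor_less_iff nat_less_iff)
          qed
          \<comment> \<open>The scaled number of shocks after the first weakening one; the weakening
            shock itself costs \<open>p t\<close>, which vanishes.\<close>
          have "((\<lambda>t. real (N t) * p t - real (m t) * p t - p t) \<longlongrightarrow> u - y * u - 0) at_top"
            by (intro tendsto_intros N m p0)
          moreover have "u - y * u - 0 = u * (1 - y)" by (simp add: algebra_simps)
          ultimately have "((\<lambda>t. real (N t) * p t - real (m t) * p t - p t) \<longlongrightarrow> u * (1 - y)) at_top"
            by simp
          then have j: "((\<lambda>t. real (N t - Suc (m t)) * p t) \<longlongrightarrow> u * (1 - y)) at_top"
            by (rule Lim_transform_eventually)
               (use less in \<open>auto elim!: eventually_mono simp: of_nat_diff algebra_simps\<close>)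
          have "((\<lambda>t. A t (m t) * B t (N t - Suc (m t))) \<longlongrightarrow> h y) at_top"
            unfolding A_def B_def h_def
          proof (rule tendsto_mult)
            show "((\<lambda>t. binomial_term k (x t) (1 - r t) (m t)) \<longlongrightarrow>
                (u * y * \<xi>) ^ k / fact k * exp (- (u * y * \<rho>))) at_top"
              unfolding mult.commute[of u y] by (rule binomial_term_tendsto[OF m]) (use p p0 x r in auto)
            have "((\<lambda>t. binomial_term l (p t) (1 - p t) (N t - Suc (m t))) \<longlongrightarrow>
                (u * (1 - y) * 1) ^ l / fact l * exp (- (u * (1 - y) * 1))) at_top"
              by (rule binomial_term_tendsto[OF j])
                 (use p(1) p0 in \<open>auto simp: p_nz\<close>)
            then show "((\<lambda>t. binomial_term l (p t) (1 - p t) (N t - Suc (m t))) \<longlongrightarrow>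
                (u * (1 - y)) ^ l / fact l * exp (- (u * (1 - y)))) at_top" by simp
          qed
          moreover have "\<forall>\<^sub>F t in at_top. A t (m t) * B t (N t - Suc (m t)) = f t (m t) / (1 / real (N t))"
            using less by eventually_elim (simp add: f_def)
          ultimately show ?thesis
            using True unfolding m_def[symmetric]
            by (auto intro: Lim_transform_eventually)
        qed
      qed
    qed
    show "(\<lambda>y. indicator {..1} y * h y) \<in> borel_measurable lborel"
      unfolding h_def by measurable
    have "integrable lborel (indicat_real {0..1::real})"
      by simp
    moreover have "indicat_real {0..1::real} = (\<lambda>y. indicat_real {0..} y * indicat_real {..1} y)"
      by (auto simp: indicator_def)
    ultimately have "integrable lborel (\<lambda>y::real. indicat_real {0..} y * indicat_real {..1} y)"
      by (rule back_subst)
    then show "set_integrable lborel {0..} (indicat_real {..1::real})"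
      by (simp add: set_integrable_def)
    show "\<forall>\<^sub>F t in at_top. \<forall>y\<ge>0. f t (nat \<lfloor>y / (1 / real (N t))\<rfloor>) / (1 / real (N t)) \<le> indicator {..1} y"
      using N_pos
    proof eventually_elim
      case (elim t)
      show ?case
      proof (intro allI impI)
        fix y :: real assume y: "y \<ge> 0"
        define m where "m = nat \<lfloor>y * real (N t)\<rfloor>"
        have "y \<le> 1" if "m < N t"
        proof (rule ccontr)
          assume "\<not> y \<le> 1"
          then have "real (N t) \<le> y * real (N t)" by (simp add: mult_le_cancel_right1)
          then have "N t \<le> m" by (simp add: m_def le_nat_floor)
          then show False using that by simp
        qed
        then show "f t (nat \<lfloor>y / (1 / real (N t))\<rfloor>) / (1 / real (N t)) \<le> indicator {..1} y"
          using A[of t] B[of t] by (simp add: m_def[symmetric] f_def mult_le_one)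
      qed
    qed
  qed (use Ninv in simp_all)
  from tendsto_mult[OF N this]
  have "((\<lambda>t. p t * (\<Sum>m<N t. A t m * B t (N t - Suc m))) \<longlongrightarrow>
      u * (LBINT y:{0..}. indicator {..1} y * h y)) at_top"
    by (rule Lim_transform_eventually)
       (use N_pos in \<open>auto elim!: eventually_mono simp: sum_divide_distrib[symmetric]\<close>)
  moreover have "(LBINT y:{0..}. indicator {..1} y * h y) = (LBINT y:{0..1}. h y)"
    unfolding set_lebesgue_integral_def
    by (intro Bochner_Integration.integral_cong) (auto simp: indicator_def)
  ultimately show ?thesis
    by (simp add: A_def B_def h_def)
qed

section \<open>The two limits, with \<open>p\<close> and \<open>q\<close> in the roles of the tails
  at \<open>\<beta>\<close> and \<open>\<gamma>\<close>\<close>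

context
  fixes p q :: "real \<Rightarrow> real" and g z :: real
  assumes p: "\<And>t. p t > 0" "(p \<longlongrightarrow> 0) at_top"
    and q: "\<And>t. p t \<le> q t" "\<And>t. q t \<le> 1"
    and g: "g > 0" "((\<lambda>t. p t / q t) \<longlongrightarrow> g) at_top"
    and z: "z \<ge> 0"
begin

lemma q_pos: "q t > 0"
  using p(1)[of t] q(1)[of t] by linarith

lemma p_le_1: "p t \<le> 1"
  using q[of t] by linarith

text \<open>On the scale \<open>v = n * q t\<close> the binomial term tends to
  \<open>(v * (1 - g)) ^ k / fact k * exp (- v)\<close>. The width contributes
  \<open>T t / q t\<close>, the product of \<open>T t / p t\<close> and \<open>p t / q t\<close>,
  with limit \<open>a * g\<close>; the cutoff \<open>z / p t\<close> becomes
  \<open>z / g\<close>.\<close>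

lemma limit_without_weakening:
  assumes T: "\<And>t. 0 \<le> T t" "\<And>t. T t \<le> p t" "((\<lambda>t. T t / p t) \<longlongrightarrow> a) at_top"
    and S: "\<And>t. (\<lambda>n. if real (Suc n) \<ge> z / p t
      then binomial_term k (q t - p t) (1 - q t) n * T t else 0) sums S t"
  shows "(S \<longlongrightarrow> g * (1 - g) ^ k * a / fact k * (LBINT v:{z / g..}. v ^ k * exp (- v))) at_top"
proof -
  have q_nz: "q t \<noteq> 0" and p_nz: "p t \<noteq> 0" for t
    using q_pos[of t] p(1)[of t] by auto
  \<comment> \<open>\<open>q\<close> is recovered as \<open>p\<close> divided by
    \<open>p / q\<close>, whose limit \<open>g\<close> is positive.\<close>
  have q0: "(q \<longlongrightarrow> 0) at_top"
    using tendsto_divide[OF p(2) g(2)] g(1) p_nz by simp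
  have "(S \<longlongrightarrow> (LBINT v:{z / g..}. g * (1 - g) ^ k * a / fact k * (v ^ k * exp (- v)))) at_top"
  proof (rule sum_tendsto_integral[where p = q and s = "\<lambda>t. z / p t"
        and f = "\<lambda>t n. binomial_term k (q t - p t) (1 - q t) n * T t"
        and w = "\<lambda>u. exp (real (Suc k)) * (u ^ k * exp (- u))"])
    show "\<forall>\<^sub>F t in at_top. 0 < q t" by (simp add: q_pos)
    show "((\<lambda>t. z / p t * q t) \<longlongrightarrow> z / g) at_top"
      using tendsto_divide[OF tendsto_const g(2), of z] g(1) by simp
    show "z / g \<ge> 0" using z g by simp
    show "\<forall>\<^sub>F t in at_top. \<forall>n. 0 \<le> binomial_term k (q t - p t) (1 - q t) n * T t"
      using q T by (simp add: binomial_term_nonneg)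
    show "AE v in lborel. 0 < v \<longrightarrow>
        ((\<lambda>t. binomial_term k (q t - p t) (1 - q t) (nat \<lfloor>v / q t\<rfloor>) * T t / q t) \<longlongrightarrow>
          g * (1 - g) ^ k * a / fact k * (v ^ k * exp (- v))) at_top"
    proof (intro AE_I2 impI)
      fix v :: real assume v: "0 < v"
      have "((\<lambda>t. binomial_term k (q t - p t) (1 - q t) (nat \<lfloor>v / q t\<rfloor>)) \<longlongrightarrow>
          (v * (1 - g)) ^ k / fact k * exp (- (v * 1))) at_top"
      proof (rule binomial_term_tendsto)
        show "((\<lambda>t. real (nat \<lfloor>v / q t\<rfloor>) * q t) \<longlongrightarrow> v) at_top"
          using v by (intro floor_scaled_tendsto q0) (auto simp: q_pos)
        show "((\<lambda>t. (q t - p t) / q t) \<longlongrightarrow> 1 - g) at_top"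
          using tendsto_diff[OF tendsto_const g(2), of 1] by (simp add: diff_divide_distrib q_nz)
      qed (auto simp: q_pos q0 q_nz)
      from tendsto_mult[OF this tendsto_mult[OF T(3) g(2)]] show
        "((\<lambda>t. binomial_term k (q t - p t) (1 - q t) (nat \<lfloor>v / q t\<rfloor>) * T t / q t) \<longlongrightarrow>
          g * (1 - g) ^ k * a / fact k * (v ^ k * exp (- v))) at_top"
        by (simp add: p_nz power_mult_distrib mult_ac)
    qed
    show "set_integrable lborel {0..} (\<lambda>u. exp (real (Suc k)) * (u ^ k * exp (- u)))"
      by (rule set_integrable_power_times_exp)
    show "\<forall>\<^sub>F t in at_top. \<forall>u\<ge>0. binomial_term k (q t - p t) (1 - q t) (nat \<lfloor>u / q t\<rfloor>) * T t / q t
        \<le> exp (real (Suc k)) * (u ^ k * exp (- u))"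
    proof (intro always_eventually allI impI)
      fix t u :: real assume u: "u \<ge> 0"
      let ?n = "nat \<lfloor>u / q t\<rfloor>"
      \<comment> \<open>The polynomial factor is bounded by \<open>u ^ k\<close>;
        \<open>geometric_floor_bounds\<close> with \<open>j = k\<close> turns the power of
        \<open>1 - q t\<close> into the exponential.\<close>
      have "real ?n * (q t - p t) \<le> real ?n * q t"
        using p(1)[of t] by (intro mult_left_mono) auto
      also have "\<dots> \<le> u"
        by (rule geometric_floor_bounds) (use q_pos q u in auto)
      finally have "(real ?n * (q t - p t)) ^ k \<le> u ^ k"
        using q[of t] by (intro power_mono) auto
      then have "(real ?n * (q t - p t)) ^ k * (1 - q t) ^ (?n - k) \<le> u ^ k * (exp (real (Suc k)) * exp (- u))"
        by (intro mult_mono geometric_floor_bounds) (use q_pos q u in auto)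
      then have le: "binomial_term k (q t - p t) (1 - q t) ?n \<le> exp (real (Suc k)) * (u ^ k * exp (- u))"
        using binomial_term_le[of "q t - p t" "1 - q t" k ?n] q[of t] by (simp add: mult_ac)
      have "T t / q t \<le> 1"
        using T(2)[of t] q(1)[of t] q_pos[of t] by simp
      then have "binomial_term k (q t - p t) (1 - q t) ?n * (T t / q t) \<le> binomial_term k (q t - p t) (1 - q t) ?n"
        using q by (intro mult_left_le) (auto simp: binomial_term_nonneg)
      then show "binomial_term k (q t - p t) (1 - q t) ?n * T t / q t \<le> exp (real (Suc k)) * (u ^ k * exp (- u))"
        using le by simp
    qed
  qed (use S q0 in auto)
  then show ?thesis by simp
qed

text \<open>Here \<open>Suc l\<close> weakening shocks occur, so \<open>l\<close> is one less than
  their number. On the scale \<open>u = n * p t\<close>, the threshold ratios converge as a bounded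
  factor \<open>D\<close>, and the sum over the first weakening time is
  \<open>binomial_convolution_tendsto\<close>.\<close>

lemma limit_with_weakening:
  assumes T: "\<And>h t. 0 \<le> T h t" "\<And>h t. T h t \<le> p t" "\<And>h. ((\<lambda>t. T h t / p t) \<longlongrightarrow> a h) at_top"
    and S: "\<And>t. (\<lambda>n. if real (Suc n) \<ge> z / p t then
        (\<Prod>h = 0..l. p t - T h t) *
        (\<Sum>m<n. binomial_term k (q t - p t) (1 - q t) m * binomial_term l 1 (1 - p t) (n - Suc m)) *
        T (Suc l) t else 0) sums S t"
  shows "(S \<longlongrightarrow> ((1 - g) / g) ^ k * (\<Prod>h = 0..l. 1 - a h) * a (Suc l) / (fact k * fact l) *
     (LBINT u:{z..}. (LBINT y:{0..1}. y ^ k * (1 - y) ^ l * exp (- y * u * (1 / g - 1)))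
         * exp (- u) * u ^ (k + Suc l))) at_top"
proof -
  have p_nz: "p t \<noteq> 0" for t
    using p(1)[of t] by auto
  define C where "C t n = (\<Sum>m<n. binomial_term k (q t - p t) (1 - q t) m *
    binomial_term l (p t) (1 - p t) (n - Suc m))" for t n
  define D where "D t = (\<Prod>h = 0..l. (p t - T h t) / p t) * (T (Suc l) t / p t)" for t
  define f where "f t n = (\<Prod>h = 0..l. p t - T h t) *
        (\<Sum>m<n. binomial_term k (q t - p t) (1 - q t) m * binomial_term l 1 (1 - p t) (n - Suc m)) *
        T (Suc l) t" for t n
  define I where "I u = (LBINT y:{0..1}. y ^ k * (1 - y) ^ l * exp (- y * u * (1 / g - 1)))" for u
  define K where "K = ((1 - g) / g) ^ k * (\<Prod>h = 0..l. 1 - a h) * a (Suc l) / (fact k * fact l)"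
  \<comment> \<open>Balance of powers of \<open>p t\<close>: \<open>D\<close> divides by
    \<open>l + 2\<close> of them, \<open>C\<close> restores \<open>l\<close>, and the explicit
    factor restores one, leaving the single division on the left.\<close>
  have f_eq: "f t n / p t = D t * (p t * C t n)" for t n
  proof -
    have "C t n = p t ^ l *
        (\<Sum>m<n. binomial_term k (q t - p t) (1 - q t) m * binomial_term l 1 (1 - p t) (n - Suc m))"
    proof -
      have B: "binomial_term l (p t) (1 - p t) j = p t ^ l * binomial_term l 1 (1 - p t) j" for j
        using scale_binomial_term[of "p t" l 1 "1 - p t" j] by simp
      show ?thesis
        unfolding C_def B sum_distrib_left by (simp only: mult.left_commute)
    qed
    moreover have "D t = (\<Prod>h = 0..l. p t - T h t) / p t ^ Suc l * (T (Suc l) t / p t)"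
      by (simp add: D_def prod_dividef)
    ultimately show ?thesis
      using p_nz[of t] by (simp add: f_def)
  qed
  have C: "0 \<le> C t n" for t n
    unfolding C_def using p_le_1 q p(1)[THEN less_imp_le]
    by (intro sum_nonneg mult_nonneg_nonneg binomial_term_nonneg) auto
  have D: "0 \<le> D t" "D t \<le> 1" for t
  proof -
    have *: "0 \<le> (p t - T h t) / p t" "(p t - T h t) / p t \<le> 1" "0 \<le> T h t / p t" "T h t / p t \<le> 1" for h
      using T(1,2)[of h t] p(1)[of t] by simp_all
    show "0 \<le> D t" unfolding D_def using * by (intro mult_nonneg_nonneg prod_nonneg) auto
    show "D t \<le> 1" unfolding D_def using * by (intro mult_le_one prod_le_1 conjI) auto
  qed
  have "(S \<longlongrightarrow> (LBINT u:{z..}. K * (I u * exp (- u) * u ^ (k + Suc l)))) at_top"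
  proof (rule sum_tendsto_integral[where p = p and s = "\<lambda>t. z / p t" and f = f
        and w = "\<lambda>u. exp (real (Suc (Suc l))) * (u ^ Suc l * exp (- u))"])
    show "\<forall>\<^sub>F t in at_top. \<forall>n. 0 \<le> f t n"
    proof (intro always_eventually allI)
      fix t n
      have "0 \<le> f t n / p t"
        unfolding f_eq using C D p(1)[of t] by simp
      then show "0 \<le> f t n" using p(1)[of t] by (simp add: zero_le_divide_iff)
    qed
    show "AE u in lborel. 0 < u \<longrightarrow>
        ((\<lambda>t. f t (nat \<lfloor>u / p t\<rfloor>) / p t) \<longlongrightarrow> K * (I u * exp (- u) * u ^ (k + Suc l))) at_top"
    proof (intro AE_I2 impI)
      fix u :: real assume u: "0 < u"
      have "((\<lambda>t. p t * C t (nat \<lfloor>u / p t\<rfloor>)) \<longlongrightarrow>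
        u * (LBINT y:{0..1}. (u * y * (1 / g - 1)) ^ k / fact k * exp (- (u * y * (1 / g))) *
          ((u * (1 - y)) ^ l / fact l * exp (- (u * (1 - y)))))) at_top"
        unfolding C_def
      proof (rule binomial_convolution_tendsto)
        show "((\<lambda>t. real (nat \<lfloor>u / p t\<rfloor>) * p t) \<longlongrightarrow> u) at_top"
          using u p by (intro floor_scaled_tendsto) auto
        show q_p: "((\<lambda>t. q t / p t) \<longlongrightarrow> 1 / g) at_top"
          using tendsto_divide[OF tendsto_const g(2), of 1] g(1) by simp
        show "((\<lambda>t. (q t - p t) / p t) \<longlongrightarrow> 1 / g - 1) at_top"
          using tendsto_diff[OF q_p tendsto_const, of 1] by (simp add: diff_divide_distrib p_nz)
      qed (use u p q q_pos p_le_1 in \<open>auto intro: less_imp_le\<close>)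
      moreover have "(LBINT y:{0..1}. (u * y * (1 / g - 1)) ^ k / fact k * exp (- (u * y * (1 / g))) *
          ((u * (1 - y)) ^ l / fact l * exp (- (u * (1 - y))))) =
          (LBINT y:{0..1}. (((1 - g) / g) ^ k / (fact k * fact l) * exp (- u) * u ^ (k + l)) *
            (y ^ k * (1 - y) ^ l * exp (- y * u * (1 / g - 1))))"
      proof (intro set_lebesgue_integral_cong allI impI)
        fix y :: real
        let ?E = "exp (- y * u * (1 / g - 1))"
        \<comment> \<open>Splitting off \<open>exp (- u)\<close>, which does not depend on
          \<open>y\<close>, changes the rate \<open>1 / g\<close> into
          \<open>1 / g - 1\<close>.\<close>
        have e: "exp (- (u * y * (1 / g))) * exp (- (u * (1 - y))) = exp (- u) * ?E"
          unfolding exp_add[symmetric] by (simp add: algebra_simps)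
        have "1 / g - 1 = (1 - g) / g"
          using g(1) by (simp add: diff_divide_distrib)
        then have k: "(u * y * (1 / g - 1)) ^ k = u ^ k * y ^ k * ((1 - g) / g) ^ k"
          by (simp only: power_mult_distrib)
        have "(u * y * (1 / g - 1)) ^ k / fact k * exp (- (u * y * (1 / g))) *
            ((u * (1 - y)) ^ l / fact l * exp (- (u * (1 - y)))) =
            (u * y * (1 / g - 1)) ^ k * (u * (1 - y)) ^ l / (fact k * fact l) *
            (exp (- (u * y * (1 / g))) * exp (- (u * (1 - y))))"
          by simp
        also have "\<dots> = (u ^ k * y ^ k * ((1 - g) / g) ^ k) * (u ^ l * (1 - y) ^ l) / (fact k * fact l) *
            (exp (- u) * ?E)"
          unfolding e k power_mult_distrib[of u "1 - y"] by (rule refl)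
        also have "\<dots> = (((1 - g) / g) ^ k / (fact k * fact l) * exp (- u) * u ^ (k + l)) *
            (y ^ k * (1 - y) ^ l * ?E)"
          by (simp add: power_add)
        finally show "(u * y * (1 / g - 1)) ^ k / fact k * exp (- (u * y * (1 / g))) *
            ((u * (1 - y)) ^ l / fact l * exp (- (u * (1 - y)))) =
          (((1 - g) / g) ^ k / (fact k * fact l) * exp (- u) * u ^ (k + l)) *
            (y ^ k * (1 - y) ^ l * ?E)" .
      qed simp
      ultimately have C_lim: "((\<lambda>t. p t * C t (nat \<lfloor>u / p t\<rfloor>)) \<longlongrightarrow>
          u * (((1 - g) / g) ^ k / (fact k * fact l) * exp (- u) * u ^ (k + l) * I u)) at_top"
        by (simp add: I_def)
      have "((\<lambda>t. \<Prod>h = 0..l. (p t - T h t) / p t) \<longlongrightarrow> (\<Prod>h = 0..l. 1 - a h)) at_top"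
      proof (rule tendsto_prod)
        fix h
        show "((\<lambda>t. (p t - T h t) / p t) \<longlongrightarrow> 1 - a h) at_top"
          using tendsto_diff[OF tendsto_const T(3)[of h], of 1] by (simp add: diff_divide_distrib p_nz)
      qed
      then have D_lim: "(D \<longlongrightarrow> (\<Prod>h = 0..l. 1 - a h) * a (Suc l)) at_top"
        unfolding D_def by (intro tendsto_mult T)
      have "(\<Prod>h = 0..l. 1 - a h) * a (Suc l) *
          (u * (((1 - g) / g) ^ k / (fact k * fact l) * exp (- u) * u ^ (k + l) * I u)) =
          K * (I u * exp (- u) * u ^ (k + Suc l))"
        by (simp add: K_def)
      then show "((\<lambda>t. f t (nat \<lfloor>u / p t\<rfloor>) / p t) \<longlongrightarrow> K * (I u * exp (- u) * u ^ (k + Suc l))) at_top"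
        unfolding f_eq using tendsto_mult[OF D_lim C_lim] by simp
    qed
    show "(\<lambda>u. K * (I u * exp (- u) * u ^ (k + Suc l))) \<in> borel_measurable lborel"
      unfolding I_def set_lebesgue_integral_def by measurable
    show "set_integrable lborel {0..} (\<lambda>u. exp (real (Suc (Suc l))) * (u ^ Suc l * exp (- u)))"
      by (rule set_integrable_power_times_exp)
    show "\<forall>\<^sub>F t in at_top. \<forall>u\<ge>0. f t (nat \<lfloor>u / p t\<rfloor>) / p t
        \<le> exp (real (Suc (Suc l))) * (u ^ Suc l * exp (- u))"
    proof (intro always_eventually allI impI)
      fix t u :: real assume u: "u \<ge> 0"
      define n where "n = nat \<lfloor>u / p t\<rfloor>"
      have pt: "0 < p t" "p t \<le> 1" by (fact p(1), fact p_le_1)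
      have np: "real n * p t \<le> u"
        unfolding n_def by (rule geometric_floor_bounds) (use pt u in auto)
      \<comment> \<open>The first factor is at most \<open>(1 - p t) ^ m\<close>, because its
        weights add up to \<open>1 - p t\<close>. Multiplied by the bound for the second factor,
        this leaves an exponent of at least \<open>n - Suc l\<close>, so the bound is the same for
        all \<open>m\<close>.\<close>
      have "C t n \<le> (\<Sum>m<n. u ^ l * (1 - p t) ^ (n - Suc l))"
        unfolding C_def
      proof (rule sum_mono)
        fix m assume "m \<in> {..<n}"
        let ?j = "n - Suc m"
        have "binomial_term k (q t - p t) (1 - q t) m \<le> (q t - p t + (1 - q t)) ^ m"
          using q by (intro binomial_term_le_power) auto
        then have 1: "binomial_term k (q t - p t) (1 - q t) m \<le> (1 - p t) ^ m" by simp
        have "real ?j * p t \<le> real n * p t"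
          using pt by (intro mult_right_mono) auto
        then have "(real ?j * p t) ^ l \<le> u ^ l"
          using np pt by (intro power_mono order_trans[OF _ np]) auto
        then have "(real ?j * p t) ^ l * (1 - p t) ^ (?j - l) \<le> u ^ l * (1 - p t) ^ (?j - l)"
          using pt by (intro mult_right_mono) auto
        then have 2: "binomial_term l (p t) (1 - p t) ?j \<le> u ^ l * (1 - p t) ^ (?j - l)"
          using binomial_term_le[of "p t" "1 - p t" l ?j] pt by simp
        have "binomial_term k (q t - p t) (1 - q t) m * binomial_term l (p t) (1 - p t) ?j \<le>
            (1 - p t) ^ m * (u ^ l * (1 - p t) ^ (?j - l))"
          using 1 2 pt q u by (intro mult_mono) (auto simp: binomial_term_nonneg)
        also have "\<dots> = u ^ l * (1 - p t) ^ (m + (?j - l))"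
          by (simp add: power_add)
        also have "\<dots> \<le> u ^ l * (1 - p t) ^ (n - Suc l)"
          using pt u by (intro mult_left_mono power_decreasing) auto
        finally show "binomial_term k (q t - p t) (1 - q t) m * binomial_term l (p t) (1 - p t) ?j \<le>
            u ^ l * (1 - p t) ^ (n - Suc l)" .
      qed
      then have "p t * C t n \<le> p t * (\<Sum>m<n. u ^ l * (1 - p t) ^ (n - Suc l))"
        using pt by simp
      also have "\<dots> = (real n * p t) * (u ^ l * (1 - p t) ^ (n - Suc l))"
        by simp
      \<comment> \<open>The \<open>n\<close> equal summands give \<open>n * p t \<le> u\<close>,
        hence one more power of \<open>u\<close>; the exponential bound is the case
        \<open>j = Suc l\<close> of \<open>geometric_floor_bounds\<close>.\<close>
      also have "\<dots> \<le> u * (u ^ l * (exp (real (Suc (Suc l))) * exp (- u)))"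
        unfolding n_def by (intro mult_mono geometric_floor_bounds order_refl) (use pt u in auto)
      finally have "p t * C t n \<le> exp (real (Suc (Suc l))) * (u ^ Suc l * exp (- u))"
        by (simp add: mult_ac)
      moreover have "f t n / p t \<le> p t * C t n"
        unfolding f_eq using D C pt by (intro mult_left_le_one_le) auto
      ultimately show "f t (nat \<lfloor>u / p t\<rfloor>) / p t \<le> exp (real (Suc (Suc l))) * (u ^ Suc l * exp (- u))"
        unfolding n_def by linarith
    qed
  qed (use S[folded f_def] p z in \<open>auto simp: p_nz\<close>)
  then show ?thesis by (simp add: I_def K_def)
qed

end

section \<open>Tails near the upper endpoint, and the assembly of the theorem\<close>

lemma (in prob_space) left_cdf_mono:
  assumes [measurable]: "Y \<in> borel_measurable M" and "x \<le> y"
  shows "left_cdf M Y x \<le> left_cdf M Y y"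
  unfolding left_cdf_def using assms(2) by (intro finite_measure_mono) auto

lemma (in prob_space) tail_le_1: "tail M Y x \<le> 1"
  by (simp add: tail_def left_cdf_def)

lemma (in prob_space) tail_nonneg: "0 \<le> tail M Y x"
  by (simp add: tail_def left_cdf_def)

lemma (in prob_space) tail_antimono:
  "Y \<in> borel_measurable M \<Longrightarrow> x \<le> y \<Longrightarrow> tail M Y y \<le> tail M Y x"
  using left_cdf_mono by (simp add: tail_def)

text \<open>The right-continuous \<open>cdf\<close> at \<open>y - 1\<close> lies below the
  left-continuous version at \<open>y\<close>, so its limit carries over.\<close>

lemma (in prob_space) left_cdf_tendsto_1:
  assumes [measurable]: "Y \<in> borel_measurable M"
  shows "(left_cdf M Y \<longlongrightarrow> 1) at_top"
proof (rule tendsto_sandwich)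
  interpret D: real_distribution "distr M borel Y"
    by (rule real_distribution_distr) simp
  show "((\<lambda>y. cdf (distr M borel Y) (y - 1)) \<longlongrightarrow> 1) at_top"
    by (rule filterlim_compose[OF D.cdf_lim_at_top_prob]) real_asymp
  have "cdf (distr M borel Y) (y - 1) \<le> left_cdf M Y y" for y
    unfolding cdf_def left_cdf_def
    by (subst measure_distr) (auto intro!: finite_measure_mono)
  then show "\<forall>\<^sub>F y in at_top. cdf (distr M borel Y) (y - 1) \<le> left_cdf M Y y" by simp
  show "\<forall>\<^sub>F y in at_top. left_cdf M Y y \<le> 1" by (simp add: left_cdf_def)
qed simp

text \<open>At a finite endpoint, continuity excludes an atom there, so \<open>left_cdf\<close>
  takes the value 1 at the endpoint and values along \<open>\<beta>\<close> converge to it. At an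
  infinite endpoint the limit at infinity is used.\<close>

lemma (in prob_space) tail_tendsto_0:
  assumes Y: "Y \<in> borel_measurable M"
    and cont: "\<And>x. upper_endpoint M Y = ereal x \<Longrightarrow> isCont (left_cdf M Y) x"
    and pos: "\<And>t. tail M Y (\<beta> t) > 0"
    and lim: "((\<lambda>t. ereal (\<beta> t)) \<longlongrightarrow> upper_endpoint M Y) F"
  shows "((\<lambda>t. tail M Y (\<beta> t)) \<longlongrightarrow> 0) F"
proof -
  have upper: "ereal y \<le> upper_endpoint M Y" if "left_cdf M Y y < 1" for y
    unfolding upper_endpoint_def by (rule Sup_upper) (use that in auto)
  have "((\<lambda>t. left_cdf M Y (\<beta> t)) \<longlongrightarrow> 1) F"
  proof (cases "upper_endpoint M Y")
    case (real x)
    have one: "left_cdf M Y y = 1" if "y > x" for y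
    proof -
      have "\<not> left_cdf M Y y < 1" using upper[of y] that real by auto
      then show ?thesis by (simp add: left_cdf_def not_less antisym)
    qed
    \<comment> \<open>The limit from the right is both the value at \<open>x\<close>, by continuity,
      and 1, since \<open>left_cdf\<close> is 1 beyond the endpoint.\<close>
    have "(left_cdf M Y \<longlongrightarrow> left_cdf M Y x) (at_right x)"
      using cont[OF real] by (auto simp: isCont_def intro: filterlim_at_split[THEN iffD1, THEN conjunct2])
    moreover have "(left_cdf M Y \<longlongrightarrow> 1) (at_right x)"
      by (rule tendsto_eventually) (use one in \<open>auto simp: eventually_at_right_less eventually_at_filter\<close>)
    ultimately have "left_cdf M Y x = 1"
      by (rule tendsto_unique[rotated]) simp
    moreover have "(\<beta> \<longlongrightarrow> x) F" using lim real by simp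
    ultimately show ?thesis
      using isCont_tendsto_compose[OF cont[OF real]] by metis
  next
    case PInf
    then have "filterlim \<beta> at_top F"
      using lim by (simp add: tendsto_PInfty_eq_at_top)
    then show ?thesis
      by (rule filterlim_compose[OF left_cdf_tendsto_1[OF Y]])
  next
    case MInf
    \<comment> \<open>\<open>undefined\<close> merely picks some index: a single real point with
      \<open>left_cdf\<close> below 1 contradicts an endpoint equal to minus infinity.\<close>
    have "left_cdf M Y (\<beta> undefined) < 1" using pos by (simp add: tail_def)
    then show ?thesis using upper MInf by fastforce
  qed
  from tendsto_diff[OF tendsto_const this, of 1] show ?thesis
    by (simp add: tail_def)
qed

theorem theorem2:
  fixes M :: "'a measure" and X :: "nat \<Rightarrow> 'a \<Rightarrow> real"
    and \<alpha> \<beta> \<gamma> :: "real \<Rightarrow> real" and b c :: "real \<Rightarrow> nat \<Rightarrow> real"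
    and g z :: real and a :: "nat \<Rightarrow> nat \<Rightarrow> real"
  assumes prob: "prob_space M"
    and indep: "prob_space.indep_vars M (\<lambda>_. borel) X {1..}"
    and ident: "\<And>i. i \<ge> 1 \<Longrightarrow> distr M borel (X i) = distr M borel (X 1)"
    and endpoint_cont: "\<And>x. upper_endpoint M (X 1) = ereal x \<Longrightarrow> isCont (left_cdf M (X 1)) x"
    and order: "\<And>t. \<gamma> t \<le> \<beta> t" "\<And>t. \<beta> t \<le> \<alpha> t"
    and tail_pos: "\<And>t. tail M (X 1) (\<beta> t) > 0"
    and alpha_lim: "((\<lambda>t. ereal (\<alpha> t)) \<longlongrightarrow> upper_endpoint M (X 1)) at_top"
    and beta_lim: "((\<lambda>t. ereal (\<beta> t)) \<longlongrightarrow> upper_endpoint M (X 1)) at_top"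
    and gamma_lim: "((\<lambda>t. ereal (\<gamma> t)) \<longlongrightarrow> upper_endpoint M (X 1)) at_top"
    and b: "\<And>t. mono (b t)" "\<And>t. b t 0 = 0" "\<And>t. b t 1 > 0"
    and c: "\<And>t. mono (c t)" "\<And>t. c t 0 = 0"
    and threshold: "\<And>t k l. \<alpha> t + b t k - c t l \<ge> \<beta> t"
    and g: "0 < g" "g < 1"
    and g_lim: "((\<lambda>t. tail M (X 1) (\<beta> t) / tail M (X 1) (\<gamma> t)) \<longlongrightarrow> g) at_top"
    and a: "\<And>k l. 0 < a k l" "\<And>k l. a k l \<le> 1"
    and a_lim: "\<And>k l. ((\<lambda>t. tail M (X 1) (\<alpha> t + b t k - c t l) / tail M (X 1) (\<beta> t))
                  \<longlongrightarrow> a k l) at_top"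
    and z: "z \<ge> 0"
  shows "(\<forall>k.
      ((\<lambda>t. measure M (shock_event M X (\<alpha> t) (\<beta> t) (\<gamma> t) (b t) (c t)
               (z / tail M (X 1) (\<beta> t)) k 0))
        \<longlongrightarrow> g * (1 - g) ^ k * a k 0 / fact k * (LBINT v:{z / g..}. v ^ k * exp (- v))) at_top)
    \<and> (\<forall>l\<ge>1. \<forall>k.
      ((\<lambda>t. measure M (shock_event M X (\<alpha> t) (\<beta> t) (\<gamma> t) (b t) (c t)
               (z / tail M (X 1) (\<beta> t)) k l))
        \<longlongrightarrow> ((1 - g) / g) ^ k * (\<Prod>h = 0..l - 1. 1 - a k h) * a k l / (fact k * fact (l - 1)) *
          (LBINT u:{z..}.
            (LBINT y:{0..1}. y ^ k * (1 - y) ^ (l - 1) * exp (- y * u * (1 / g - 1)))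
              * exp (- u) * u ^ (k + l))) at_top)"
proof -
  interpret prob_space M by (rule prob)
  have X1: "X 1 \<in> borel_measurable M"
    using indep by (auto simp: indep_vars_def)
  \<comment> \<open>Continuity at the upper endpoint enters here: it makes the tail at
    \<open>\<beta> t\<close>, the step width, tend to 0.\<close>
  note p0 = tail_tendsto_0[OF X1 endpoint_cont tail_pos beta_lim]
  note pq = tail_antimono[OF X1 order(1)]
  note Tp = tail_antimono[OF X1 threshold]
  have model: "shock_model M X (\<alpha> t) (\<beta> t) (\<gamma> t) (b t) (c t)" for t
    by (intro shock_model.intro shock_model_axioms.intro prob indep order threshold ident)
  note sums = shock_model.shock_event_sums[OF model]
  show ?thesis
  proof (intro conjI allI impI)
    fix k
    show "((\<lambda>t. measure M (shock_event M X (\<alpha> t) (\<beta> t) (\<gamma> t) (b t) (c t)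
          (z / tail M (X 1) (\<beta> t)) k 0))
        \<longlongrightarrow> g * (1 - g) ^ k * a k 0 / fact k * (LBINT v:{z / g..}. v ^ k * exp (- v))) at_top"
      by (rule limit_without_weakening[OF tail_pos p0 pq tail_le_1 g(1) g_lim z tail_nonneg Tp a_lim
            sums[where l = 0, unfolded shock_model.survive_prob_eq_0[OF model]]])
  next
    fix l k :: nat assume "l \<ge> 1"
    then obtain j where l: "l = Suc j" by (cases l) auto
    show "((\<lambda>t. measure M (shock_event M X (\<alpha> t) (\<beta> t) (\<gamma> t) (b t) (c t)
               (z / tail M (X 1) (\<beta> t)) k l))
        \<longlongrightarrow> ((1 - g) / g) ^ k * (\<Prod>h = 0..l - 1. 1 - a k h) * a k l / (fact k * fact (l - 1)) *
          (LBINT u:{z..}.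
            (LBINT y:{0..1}. y ^ k * (1 - y) ^ (l - 1) * exp (- y * u * (1 / g - 1)))
              * exp (- u) * u ^ (k + l))) at_top"
      unfolding l diff_Suc_1
      by (rule limit_with_weakening[OF tail_pos p0 pq tail_le_1 g(1) g_lim z tail_nonneg Tp a_lim
            sums[where l = "Suc j", unfolded shock_model.survive_prob_eq_Suc[OF model]]])
  qed
qed

end
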